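(* Consider the two-player zero-sum sequential game described in the context. Suppose that the following two assumptions hold. (i) There exists $m\in\mathbb{N}$ such that $$\rho:=\sup_{\pi_R\in\overline\Pi_R,\ \pi_P\in\overline\Pi_P,\ s\in\mathcal S}\mathbb{P}^{\pi_R,\pi_P}[S_m\neq\Delta\mid S_0=s]<1 .$$ (ii) For every $s\in\mathcal S$ and all sequences $a_R^k\in A_R(s)$, $a_P^k\in A_P(s,a_R^k)$ with $\lim_{k\to\infty} a_R^k=a_R\in A_R(s)$ and $\lim_{k\to\infty}a_P^k=a_P\in A_P(s,a_R)$, one has $\lim_{k\to\infty}p(s'|s,a_R^k,a_P^k)=p(s'|s,a_R,a_P)$ for all $s'\in\mathcal S$. Then: (a) The optimal value function $V^*$ is the unique solution, among $u\in\mathbb{R}^{|\mathcal S|}$ with $u(\Delta)=0$, to $u=Tu$; i.e. it is the unique such function satisfying $$V^*(s)=\max_{a_R\in A_R(s)}\ \min_{a_P\in A_P(s,a_R)}\ \sum_{s'\in\mathcal S}[r(s'|s)+V^*(s')]\,p(s'|s,a_R,a_P)\qquad\forall s\in\mathcal S.$$ (b) For any $\pi_R\in\Pi_R$ and $\pi_P\in\Pi_P$, the function $V^{\pi_R,\pi_P}$ is the unique solution, among $u\in\mathbb{R}^{|\mathcal S|}$ with $u(\Delta)=0$, to $u=T_{\pi_R,\pi_P}u$; i.e. it is the unique such function satisfying $$V^{\pi_R,\pi_P}(s)=\sum_{s'\in\mathcal S}[r(s'|s)+V^{\pi_R,\pi_P}(s')]\,p(s'|s,\pi_R(s),\pi_P(s,\pi_R(s)))\qquad\forall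 s\in\mathcal S.$$
   Context: **States.** $\mathcal X$ is the set of $s=(b,c,d,o)$ with $b\in\{0,1\}^3$, $c\in\{0,1,2,3\}\times\{0,1,2\}$, $d\in\{0,1,2\}$, $o\in\{0,1,2\}$. $\widetilde{\mathcal X}=\{0,1,2,3\}$ is a set of four "penultimate" states (disjoint from $\mathcal X$), and $\Delta$ is a terminal state. The state space is the finite set $\mathcal S=\mathcal X\cup\widetilde{\mathcal X}\cup\{\Delta\}$. **Actions.** There are a runner (maximizer) and a pitcher (minimizer); $\delta$ is a dummy action. The runner's action set is $A_R(s)=[0,20]$ if $s=(b,c,d,o)\in\mathcal X$ with $b=(1,0,0)$, and $A_R(s)=\{\delta\}$ for all other $s\in\mathcal S$. For $a_R\in A_R(s)$, the pitcher's action set is $A_P(s,a_R)=\{0,1\}$ if $s=(b,c,d,o)\in\mathcal X$ with $b=(1,0,0)$, and $A_P(s,a_R)=\{\delta\}$ for all other $s\in\mathcal S$. **Transitions.** For all $s\in\mathcal S$, $a_R\in A_R(s)$, $a_P\in A_P(s,a_R)$, $p(\cdot\mid s,a_R,a_P)$ is a probability distribution on $\mathcal S$. Every state of $\widetilde{\mathcal X}$ moves to $\Delta$ with probability 1, and $\Delta$ is absorbing. At each stage the runner chooses $a_R\in A_R(s)$ after observing $s$; the pitcher chooses $a_P\in A_P(s,a_R)$ after observing $(s,a_R)$; the next state is drawn from $p(\cdot\mid s,a_R,a_P)$. **Rewards.** With $g:\{0,1\}^3\to\{0,1,2,3\}$ the number of ones in $b$, the reward for a transition from $s$ to $s'$ is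 $r(s'|s)=(g(b)+o)-(g(b')+o')+\mathbb{I}\{c'=(0,0),\,d'=0\}$ if $s=(b,c,d,o),\,s'=(b',c',d',o')\in\mathcal X$; $r(s'|s)=s'$ if $s\in\mathcal X$, $s'\in\widetilde{\mathcal X}$; $r(s'|s)=0$ if $s'=\Delta$. The remaining pairs have transition probability zero; their reward is irrelevant and may be set to $0$. **Policies.** $\mathbb{F}_R$ is the set of functions $f$ on $\mathcal S$ with $f(s)\in A_R(s)$ for all $s$. $\mathbb{K}_P=\{(s,a_R): s\in\mathcal S,\ a_R\in A_R(s)\}$, and $\mathbb{F}_P$ is the set of functions $f$ on $\mathbb{K}_P$ with $f(s,a_R)\in A_P(s,a_R)$ for all $(s,a_R)\in\mathbb K_P$. A deterministic Markovian policy for the runner (resp. pitcher) is a sequence $(\pi_0,\pi_1,\ldots)$ in $\mathbb{F}_R$ (resp. $\mathbb{F}_P$); the set of these is $\overline\Pi_R$ (resp. $\overline\Pi_P$). It is stationary if all $\pi_t$ equal one decision rule; $\Pi_R\subseteq\overline\Pi_R$ and $\Pi_P\subseteq\overline\Pi_P$ denote the sets of stationary policies, and a stationary policy is identified with its decision rule. **Values.** $S_t$ is the state at stage $t$; $\mathbb{P}^{\pi_R,\pi_P}$ and $\mathbb{E}^{\pi_R,\pi_P}$ are the probability and expectation induced by the policies. Define $$V^{\pi_R,\pi_P}(s)=\mathbb{E}^{\pi_R,\pi_P}\Big[\sum_{t=0}^\infty r(S_{t+1}|S_t)\,\Big|\,S_0=s\Big],\qquad V^*(s)=\max_{\pi_R\in\overline\Pi_R}\min_{\pi_P\in\overline\Pi_P}V^{\pi_R,\pi_P}(s),\quad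 s\in\mathcal S.$$ (In the definition of $V^*$, max and min are read as supremum and infimum, so that no attainment is presupposed.) **Operators.** For $u\in\mathbb{R}^{|\mathcal S|}$ with $u(\Delta)=0$, $\pi_R\in\Pi_R$, $\pi_P\in\Pi_P$, and $s\in\mathcal S$, $$(T_{\pi_R,\pi_P}u)(s)=\sum_{s'\in\mathcal S}[r(s'|s)+u(s')]\,p(s'|s,\pi_R(s),\pi_P(s,\pi_R(s))),$$ $$(Tu)(s)=\max_{a_R\in A_R(s)}\ \min_{a_P\in A_P(s,a_R)}\ \sum_{s'\in\mathcal S}[r(s'|s)+u(s')]\,p(s'|s,a_R,a_P).$$ *)

theory Defs
  imports "HOL-Probability.Probability"
begin

text \<open>
  \<open>Live b c d o\<close> is a state of \<open>\<X>\<close>, \<open>Penult k\<close> one of the four penultimate states and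
  \<open>Terminal\<close> the state \<open>\<Delta>\<close>.  The type is larger than the state space; the ranges of the
  components are imposed by the carrier set \<open>states\<close>.
\<close>

datatype state =
    Live "nat \<times> nat \<times> nat" "nat \<times> nat" nat nat
  | Penult nat
  | Terminal

instance state :: countable
  by countable_datatype

definition live_states :: "state set" where
  "live_states = {Live b c d outs | b c d outs.
     b \<in> {0, 1} \<times> {0, 1} \<times> {0, 1} \<and> c \<in> {0, 1, 2, 3} \<times> {0, 1, 2} \<and>
     d \<in> {0, 1, 2} \<and> outs \<in> {0, 1, 2}}"

definition penult_states :: "state set" where
  "penult_states = Penult ` {0, 1, 2, 3}"

definition states :: "state set" where
  "states = live_states \<union> penult_states \<union> {Terminal}"

text \<open>
  Both players draw their actions from one type: a real number, or the dummy action \<open>\<delta>\<close>.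
  It carries the topology of the disjoint union of the real line and a point, so that limits of
  actions are limits of real numbers and \<open>Dummy\<close> is isolated.
\<close>

datatype action = Num real | Dummy

instantiation action :: topological_space
begin

definition open_action :: "action set \<Rightarrow> bool" where
  "open_action U \<longleftrightarrow> open (Num -` U)"

instance
proof
  show "open (UNIV :: action set)"
    by (simp add: open_action_def)
  show "open (S \<inter> T)" if "open S" "open T" for S T :: "action set"
    using that by (auto simp: open_action_def)
  show "open (\<Union>K)" if "\<forall>S\<in>K. open S" for K :: "action set set"
    using that by (auto simp: open_action_def vimage_Union)
qed

end

lemma tendsto_Num_iff: "((\<lambda>x. Num (f x)) \<longlongrightarrow> Num l) F \<longleftrightarrow> (f \<longlongrightarrow> l) F"
proof
  assume lim: "((\<lambda>x. Num (f x)) \<longlongrightarrow> Num l) F"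
  show "(f \<longlongrightarrow> l) F"
  proof (rule topological_tendstoI)
    fix S assume "open S" "l \<in> S"
    moreover have "Num -` (Num ` S) = S"
      by auto
    ultimately have "open (Num ` S)" "Num l \<in> Num ` S"
      by (auto simp: open_action_def)
    from topological_tendstoD[OF lim this] show "\<forall>\<^sub>F x in F. f x \<in> S"
      by (rule eventually_mono) auto
  qed
next
  assume lim: "(f \<longlongrightarrow> l) F"
  show "((\<lambda>x. Num (f x)) \<longlongrightarrow> Num l) F"
  proof (rule topological_tendstoI)
    fix S assume "open S" "Num l \<in> S"
    then have "open (Num -` S)" "l \<in> Num -` S"
      by (auto simp: open_action_def)
    from topological_tendstoD[OF lim this] show "\<forall>\<^sub>F x in F. Num (f x) \<in> S"
      by simp
  qed
qed

fun steal_state :: "state \<Rightarrow> bool" where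
  "steal_state (Live b c d outs) \<longleftrightarrow> b = (1, 0, 0)"
| "steal_state _ \<longleftrightarrow> False"

definition runner_actions :: "state \<Rightarrow> action set" where
  "runner_actions s = (if steal_state s then Num ` {0..20} else {Dummy})"

definition pitcher_actions :: "state \<Rightarrow> action \<Rightarrow> action set" where
  "pitcher_actions s a = (if steal_state s then {Num 0, Num 1} else {Dummy})"

fun bases_count :: "nat \<times> nat \<times> nat \<Rightarrow> nat" where
  "bases_count (b1, b2, b3) = b1 + b2 + b3"

text \<open>\<open>reward s s'\<close> is \<open>r(s'|s)\<close>.\<close>

fun reward :: "state \<Rightarrow> state \<Rightarrow> real" where
  "reward (Live b c d outs) (Live b' c' d' outs') =
     (real (bases_count b) + real outs) - (real (bases_count b') + real outs')
       + of_bool (c' = (0, 0) \<and> d' = 0)"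
| "reward (Live b c d outs) (Penult k) = real k"
| "reward _ _ = 0"

text \<open>
  \<open>pmf (p s a\<^sub>R a\<^sub>P) s'\<close> is \<open>p(s'|s, a\<^sub>R, a\<^sub>P)\<close>.  Only the values of \<open>p\<close> at states of the
  carrier and admissible actions are constrained.
\<close>

type_synonym transitions = "state \<Rightarrow> action \<Rightarrow> action \<Rightarrow> state pmf"

definition transition_law :: "transitions \<Rightarrow> bool" where
  "transition_law p \<longleftrightarrow>
     (\<forall>s\<in>states. \<forall>a\<in>runner_actions s. \<forall>a'\<in>pitcher_actions s a. set_pmf (p s a a') \<subseteq> states) \<and>
     (\<forall>s\<in>penult_states. p s Dummy Dummy = return_pmf Terminal) \<and>
     p Terminal Dummy Dummy = return_pmf Terminal"

type_synonym runner_rule = "state \<Rightarrow> action"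
type_synonym pitcher_rule = "state \<times> action \<Rightarrow> action"

definition runner_rules :: "runner_rule set" where
  "runner_rules = (\<Pi>\<^sub>E s\<in>states. runner_actions s)"

definition pitcher_rules :: "pitcher_rule set" where
  "pitcher_rules = (\<Pi>\<^sub>E (s, a)\<in>(SIGMA s:states. runner_actions s). pitcher_actions s a)"

text \<open>
  Deterministic Markovian policies.  The stationary policy with decision rule \<open>f\<close> is \<open>\<lambda>_. f\<close>.
\<close>

definition runner_policies :: "(nat \<Rightarrow> runner_rule) set" where
  "runner_policies = {\<pi>. \<forall>t. \<pi> t \<in> runner_rules}"

definition pitcher_policies :: "(nat \<Rightarrow> pitcher_rule) set" where
  "pitcher_policies = {\<sigma>. \<forall>t. \<sigma> t \<in> pitcher_rules}"

definition next_pmf :: "transitions \<Rightarrow> runner_rule \<Rightarrow> pitcher_rule \<Rightarrow> state \<Rightarrow> state pmf" where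
  "next_pmf p f h s = p s (f s) (h (s, f s))"

text \<open>
  \<open>history_kernel p \<pi> \<sigma> s n \<omega>\<close> is the conditional law of \<open>S\<^sub>n\<close> given that the earlier states
  are \<open>\<omega> 0, \<dots>, \<omega> (n - 1)\<close>, for the process started in \<open>s\<close>.  The law of the whole process, a
  measure on \<open>nat \<Rightarrow> state\<close> whose coordinates are the \<open>S\<^sub>t\<close>, is the one given by the
  Ionescu-Tulcea theorem.
\<close>

definition history_kernel ::
    "transitions \<Rightarrow> (nat \<Rightarrow> runner_rule) \<Rightarrow> (nat \<Rightarrow> pitcher_rule) \<Rightarrow> state \<Rightarrow>
     nat \<Rightarrow> (nat \<Rightarrow> state) \<Rightarrow> state measure" where
  "history_kernel p \<pi> \<sigma> s n \<omega> =
     measure_pmf (case n of 0 \<Rightarrow> return_pmf s | Suc t \<Rightarrow> next_pmf p (\<pi> t) (\<sigma> t) (\<omega> t))"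

definition process_law ::
    "transitions \<Rightarrow> (nat \<Rightarrow> runner_rule) \<Rightarrow> (nat \<Rightarrow> pitcher_rule) \<Rightarrow> state \<Rightarrow>
     (nat \<Rightarrow> state) measure" where
  "process_law p \<pi> \<sigma> s =
     projective_family.lim UNIV
       (Ionescu_Tulcea.CI (history_kernel p \<pi> \<sigma> s) (\<lambda>_. count_space UNIV))
       (\<lambda>_. count_space UNIV)"

lemma Ionescu_Tulcea_history_kernel:
  "Ionescu_Tulcea (history_kernel p \<pi> \<sigma> s) (\<lambda>_. count_space UNIV)"
proof (rule Ionescu_Tulcea.intro)
  fix n
  let ?M = "PiM {0..<n} (\<lambda>_. count_space UNIV) :: (nat \<Rightarrow> state) measure"
  show "history_kernel p \<pi> \<sigma> s n \<in> measurable ?M (subprob_algebra (count_space UNIV))"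
  proof (cases n)
    case 0
    have "history_kernel p \<pi> \<sigma> s 0 = (\<lambda>_. measure_pmf (return_pmf s))"
      by (simp add: history_kernel_def fun_eq_iff)
    with 0 show ?thesis
      by (simp add: measure_pmf_in_subprob_algebra)
  next
    case (Suc t)
    have "(\<lambda>x. measure_pmf (next_pmf p (\<pi> t) (\<sigma> t) x))
        \<in> measurable (count_space UNIV) (subprob_algebra (count_space UNIV))"
      by (simp add: measure_pmf_in_subprob_algebra)
    moreover have "(\<lambda>\<omega>. \<omega> t) \<in> measurable ?M (count_space UNIV)"
      using Suc by (intro measurable_component_singleton) simp
    ultimately show ?thesis
      unfolding history_kernel_def Suc nat.case by (rule measurable_compose[rotated])
  qed
next
  fix n \<omega>
  show "prob_space (history_kernel p \<pi> \<sigma> s n \<omega>)"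
    by (simp add: history_kernel_def prob_space_measure_pmf)
qed

lemma space_process_law: "space (process_law p \<pi> \<sigma> s) = UNIV"
proof -
  interpret Ionescu_Tulcea "history_kernel p \<pi> \<sigma> s" "\<lambda>_. count_space UNIV"
    by (rule Ionescu_Tulcea_history_kernel)
  show ?thesis
    by (simp add: process_law_def space_PiM)
qed

text \<open>The law is characterized by its values on cylinders.\<close>

lemma emeasure_process_law_cylinder:
  "emeasure (process_law p \<pi> \<sigma> s) {\<omega>. \<forall>i\<le>n. \<omega> i = x i} =
     of_bool (x 0 = s) * (\<Prod>i<n. ennreal (pmf (next_pmf p (\<pi> i) (\<sigma> i) (x i)) (x (Suc i))))"
proof -
  let ?K = "history_kernel p \<pi> \<sigma> s"
  interpret Ionescu_Tulcea ?K "\<lambda>_. count_space UNIV"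
    by (rule Ionescu_Tulcea_history_kernel)
  define Y where "Y k = {restrict x {0..<k}}" for k
  have Y_eq: "Y k = (\<Pi>\<^sub>E i\<in>{0..<k}. {x i})" for k
    by (force simp: Y_def PiE_def Pi_def extensional_def fun_eq_iff)
  have sets_Y: "Y k \<in> sets (PiM {0..<k} (\<lambda>_. count_space UNIV))" for k
    unfolding Y_eq by (intro sets_PiM_I_finite) auto
  have step: "emeasure (C 0 (Suc k) (\<lambda>_. undefined)) (Y (Suc k)) =
      emeasure (C 0 k (\<lambda>_. undefined)) (Y k) * emeasure (?K k x) {x k}" for k
  proof -
    have sp: "space (PiM {0..<k} (\<lambda>_. count_space (UNIV :: state set))) \<noteq> {}"
      by (simp add: space_PiM PiE_eq_empty_iff)
    have "emeasure (C 0 (Suc k) (\<lambda>_. undefined)) (Y (Suc k)) =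
        (\<integral>\<^sup>+\<omega>. emeasure (eP k \<omega>) (Y (Suc k)) \<partial>C 0 k (\<lambda>_. undefined))"
      using measurable_eP[of k] sets_Y[of "Suc k"]
      by (subst C.simps, subst emeasure_bind[where N = "PiM {0..<Suc k} (\<lambda>_. count_space UNIV)"])
         (auto simp: space_C space_PiM PiE_eq_empty_iff sets_C cong: measurable_cong_sets)
    also have "\<dots> = (\<integral>\<^sup>+\<omega>. emeasure (?K k x) {x k} * indicator (Y k) \<omega> \<partial>C 0 k (\<lambda>_. undefined))"
    proof (rule nn_integral_cong)
      fix \<omega> assume "\<omega> \<in> space (C 0 k (\<lambda>_. undefined))"
      then have \<omega>: "\<omega> \<in> space (PiM {0..<k} (\<lambda>_. count_space UNIV))"
        by (simp add: space_C space_PiM)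
      have *: "emeasure (eP k \<omega>) (Y (Suc k)) = emeasure (?K k \<omega>) ((\<lambda>y. fun_upd \<omega> k y) -` Y (Suc k))"
        using emeasure_eP[OF \<omega> sets_Y[of "Suc k"]] by simp
      have ext: "\<omega> i = undefined" if "\<not> i < k" for i
        using \<omega> that by (simp add: space_PiM PiE_def extensional_def)
      have upd: "fun_upd \<omega> k y \<in> Y (Suc k) \<longleftrightarrow> \<omega> \<in> Y k \<and> y = x k" for y
      proof -
        have "fun_upd \<omega> k y \<in> Y (Suc k) \<longleftrightarrow> (\<forall>i<k. \<omega> i = x i) \<and> y = x k"
          using ext by (auto simp: Y_def fun_eq_iff less_Suc_eq)
        also have "(\<forall>i<k. \<omega> i = x i) \<longleftrightarrow> \<omega> \<in> Y k"
          using ext by (auto simp: Y_def fun_eq_iff)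
        finally show ?thesis .
      qed
      show "emeasure (eP k \<omega>) (Y (Suc k)) = emeasure (?K k x) {x k} * indicator (Y k) \<omega>"
      proof (cases "\<omega> \<in> Y k")
        case True
        then have "(\<lambda>y. fun_upd \<omega> k y) -` Y (Suc k) = {x k}"
          by (auto simp: upd)
        moreover have "?K k \<omega> = ?K k x"
          using True by (cases k) (auto simp: history_kernel_def Y_def)
        ultimately show ?thesis using True * by simp
      next
        case False
        then have "(\<lambda>y. fun_upd \<omega> k y) -` Y (Suc k) = {}"
          by (auto simp: upd)
        then show ?thesis using False * by simp
      qed
    qed
    also have "\<dots> = emeasure (?K k x) {x k} * emeasure (C 0 k (\<lambda>_. undefined)) (Y k)"
      using sets_Y[of k] by (subst nn_integral_cmult_indicator) (auto simp: sets_C space_PiM)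
    finally show ?thesis by (simp add: mult.commute)
  qed
  have base: "emeasure (C 0 0 (\<lambda>_. undefined)) (Y 0) = 1"
    using sets_Y[of 0] by (simp add: Y_def restrict_def)
  have C: "emeasure (C 0 (Suc k) (\<lambda>_. undefined)) (Y (Suc k)) =
     of_bool (x 0 = s) * (\<Prod>i<k. ennreal (pmf (next_pmf p (\<pi> i) (\<sigma> i) (x i)) (x (Suc i))))" for k
  proof (induction k)
    case 0
    then show ?case
      by (subst step, subst base) (simp add: history_kernel_def indicator_def)
  next
    case (Suc k)
    show ?case
      by (subst step, subst Suc.IH) (simp add: history_kernel_def emeasure_pmf_single mult.assoc)
  qed
  have cyl: "{\<omega>. \<forall>i\<le>n. \<omega> i = x i} = PF.emb UNIV {0..<Suc n} (Y (Suc n))"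
    by (auto simp: prod_emb_def Y_def space_PiM fun_eq_iff restrict_def less_Suc_eq_le) meson
  have "emeasure (process_law p \<pi> \<sigma> s) {\<omega>. \<forall>i\<le>n. \<omega> i = x i} =
      emeasure (C 0 (Suc n) (\<lambda>_. undefined)) (PF.emb {0..<Suc n} {0..<Suc n} (Y (Suc n)))"
    unfolding process_law_def cyl
    by (simp add: lim sets_Y emeasure_CI[where n = "Suc n"] del: C.simps)
  also have "PF.emb {0..<Suc n} {0..<Suc n} (Y (Suc n)) = Y (Suc n)"
    using sets.sets_into_space[OF sets_Y[of "Suc n"]] by (intro prod_emb_id) (simp add: space_PiM)
  finally show ?thesis
    by (simp only: C)
qed
definition policy_value ::
    "transitions \<Rightarrow> (nat \<Rightarrow> runner_rule) \<Rightarrow> (nat \<Rightarrow> pitcher_rule) \<Rightarrow> state \<Rightarrow> real" where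
  "policy_value p \<pi> \<sigma> s = (\<integral>\<omega>. (\<Sum>t. reward (\<omega> t) (\<omega> (Suc t))) \<partial>process_law p \<pi> \<sigma> s)"

text \<open>
  The maximum and minimum over policies are read as supremum and infimum.
\<close>

definition optimal_value :: "transitions \<Rightarrow> state \<Rightarrow> real" where
  "optimal_value p s =
     (SUP \<pi>\<in>runner_policies. INF \<sigma>\<in>pitcher_policies. policy_value p \<pi> \<sigma> s)"

definition stage_value :: "transitions \<Rightarrow> (state \<Rightarrow> real) \<Rightarrow> state \<Rightarrow> action \<Rightarrow> action \<Rightarrow> real" where
  "stage_value p u s a a' = (\<Sum>s'\<in>states. (reward s s' + u s') * pmf (p s a a') s')"

definition policy_operator ::
    "transitions \<Rightarrow> runner_rule \<Rightarrow> pitcher_rule \<Rightarrow> (state \<Rightarrow> real) \<Rightarrow> state \<Rightarrow> real" where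
  "policy_operator p f h u s = stage_value p u s (f s) (h (s, f s))"

definition guaranteed_value :: "transitions \<Rightarrow> (state \<Rightarrow> real) \<Rightarrow> state \<Rightarrow> action \<Rightarrow> real" where
  "guaranteed_value p u s a = Min (stage_value p u s a ` pitcher_actions s a)"

text \<open>
  \<open>runner_actions s\<close> is infinite at a steal state, so the maximum over it is written as a
  supremum; that it is attained has to be established separately.
\<close>

definition bellman_operator :: "transitions \<Rightarrow> (state \<Rightarrow> real) \<Rightarrow> state \<Rightarrow> real" where
  "bellman_operator p u s = (SUP a\<in>runner_actions s. guaranteed_value p u s a)"

end

theory Submission
  imports Defs
begin

text \<open>
  The probability of not being absorbed within \<open>n\<close> stages is at most geometric in \<open>n\<close>, uniformly
  in the policies.  Hence the total reward is absolutely summable, the iterates of the Bellman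
  operator \<open>T\<close> started at \<open>0\<close> are Cauchy, and their limit is a fixed point of \<open>T\<close>.

  The rest is a comparison principle: a bounded sequence \<open>D\<^sub>n\<close> of functions with \<open>D\<^sub>n(\<Delta>) \<le> 0\<close> and
  \<open>D\<^sub>n \<le> P\<^sub>n D\<^sub>n\<^sub>+\<^sub>1\<close> along some policy pair satisfies \<open>D\<^sub>0 \<le> 0\<close>.  If \<open>u = Tu\<close>, let \<open>f\<close> attain the
  maxima and \<open>h\<close> the minima in \<open>Tu\<close>; comparing \<open>u\<close> with the values of the shifted policies gives
  \<open>V(f, \<sigma>) \<ge> u\<close> for every \<open>\<sigma>\<close> and \<open>V(\<pi>, h) \<le> u\<close> for every \<open>\<pi>\<close>, so \<open>u\<close> is the optimal value.  This
  yields uniqueness and the fixed-point property of the optimal value at once.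
\<close>

subsection \<open>Marginals of the process law\<close>

text \<open>The law of the state at stage \<open>n\<close>, built inside \<open>pmf\<close> by the
  Markov recursion so that later estimates are finite sums instead of integrals over paths;
  \<open>distr_process_law_state\<close> ties it to \<open>process_law\<close>.\<close>

primrec state_at ::
    "transitions \<Rightarrow> (nat \<Rightarrow> runner_rule) \<Rightarrow> (nat \<Rightarrow> pitcher_rule) \<Rightarrow> nat \<Rightarrow> state \<Rightarrow> state pmf" where
  "state_at p \<pi> \<sigma> 0 s = return_pmf s"
| "state_at p \<pi> \<sigma> (Suc n) s = bind_pmf (state_at p \<pi> \<sigma> n s) (next_pmf p (\<pi> n) (\<sigma> n))"

text \<open>Chapman-Kolmogorov: after \<open>m\<close> stages the process restarts from its current
  state under the policies shifted by \<open>m\<close>.\<close>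

lemma state_at_add:
  "state_at p \<pi> \<sigma> (m + n) s =
     bind_pmf (state_at p \<pi> \<sigma> m s) (state_at p (\<lambda>t. \<pi> (m + t)) (\<lambda>t. \<sigma> (m + t)) n)"
  by (induction n) (simp_all add: bind_return_pmf' bind_assoc_pmf)

text \<open>Splits off the first transition, whereas the defining recursion splits off the last
  one.\<close>

lemma state_at_Suc_shift:
  "state_at p \<pi> \<sigma> (Suc n) s =
     bind_pmf (next_pmf p (\<pi> 0) (\<sigma> 0) s) (state_at p (\<lambda>t. \<pi> (Suc t)) (\<lambda>t. \<sigma> (Suc t)) n)"
  using state_at_add[of p \<pi> \<sigma> 1 n s] by (simp add: bind_return_pmf)

section \<open>Measurability of coordinates and laws of one or two successive states\<close>

lemma sets_process_law:
  "sets (process_law p \<pi> \<sigma> s) = sets (PiM UNIV (\<lambda>_. count_space UNIV))"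
proof -
  interpret Ionescu_Tulcea "history_kernel p \<pi> \<sigma> s" "\<lambda>_. count_space UNIV"
    by (rule Ionescu_Tulcea_history_kernel)
  show ?thesis
    by (simp add: process_law_def)
qed

lemma measurable_coordinate [measurable]:
  "(\<lambda>\<omega>. \<omega> n) \<in> measurable (process_law p \<pi> \<sigma> s) (count_space UNIV)"
  by (simp add: measurable_cong_sets[OF sets_process_law refl] measurable_component_singleton)

lemma sets_coordinate: "{\<omega>. \<omega> n = x} \<in> sets (process_law p \<pi> \<sigma> s)"
proof -
  have "{\<omega> \<in> space (process_law p \<pi> \<sigma> s). \<omega> n = x} \<in> sets (process_law p \<pi> \<sigma> s)"
    by measurable
  then show ?thesis by (simp add: space_process_law)
qed

lemma sets_two_coordinates: "{\<omega>. \<omega> m = x \<and> \<omega> n = y} \<in> sets (process_law p \<pi> \<sigma> s)"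
proof -
  have "{\<omega>. \<omega> m = x \<and> \<omega> n = y} = {\<omega>. \<omega> m = x} \<inter> {\<omega>. \<omega> n = y}"
    by auto
  then show ?thesis
    by (simp add: sets_coordinate sets.Int)
qed

lemma sets_cylinder: "{\<omega>. \<forall>i\<le>n. \<omega> i = x i} \<in> sets (process_law p \<pi> \<sigma> s)"
proof -
  have "{\<omega>. \<forall>i\<le>n. \<omega> i = x i} = (\<Inter>i\<in>{..n}. {\<omega>. \<omega> i = x i})"
    by auto
  also have "\<dots> \<in> sets (process_law p \<pi> \<sigma> s)"
    by (intro sets.finite_INT) (auto simp: sets_coordinate)
  finally show ?thesis .
qed

text \<open>The Markov property. The event is a countable disjoint union of cylinders, one per
  history ending in \<open>x\<close>, and prolonging any of these by \<open>y\<close> multiplies its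
  probability by the same factor, which depends on \<open>x\<close> only.\<close>

lemma emeasure_process_law_step:
  "emeasure (process_law p \<pi> \<sigma> s) {\<omega>. \<omega> n = x \<and> \<omega> (Suc n) = y} =
     emeasure (process_law p \<pi> \<sigma> s) {\<omega>. \<omega> n = x} * ennreal (pmf (next_pmf p (\<pi> n) (\<sigma> n) x) y)"
proof -
  let ?P = "process_law p \<pi> \<sigma> s"
  let ?q = "ennreal (pmf (next_pmf p (\<pi> n) (\<sigma> n) x) y)"
  \<comment> \<open>Histories are taken extensional on \<open>{..n}\<close>, so each path lies in
    exactly one \<open>C z\<close> (its restriction selects \<open>z\<close>), and \<open>I\<close>
    is countable as part of a finite product of a countable type.\<close>
  define I where "I = {z \<in> (\<Pi>\<^sub>E i\<in>{..n}. UNIV :: state set). z n = x}"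
  define C where "C z = {\<omega> :: nat \<Rightarrow> state. \<forall>i\<le>n. \<omega> i = z i}" for z
  define C' where "C' z = {\<omega> :: nat \<Rightarrow> state. \<forall>i\<le>Suc n. \<omega> i = (z(Suc n := y)) i}" for z
  have I: "countable I"
    unfolding I_def by (rule countable_subset[OF _ countable_PiE[of "{..n}" "\<lambda>_. UNIV"]]) auto
  have C'_eq: "C' z = C z \<inter> {\<omega>. \<omega> (Suc n) = y}" for z
    by (auto simp: C_def C'_def le_Suc_eq)
  have "\<omega> \<in> (\<Union>z\<in>I. C z)" if "\<omega> n = x" for \<omega>
    by (rule UN_I[of "restrict \<omega> {..n}"]) (use that in \<open>auto simp: I_def C_def\<close>)
  then have union: "{\<omega>. \<omega> n = x} = (\<Union>z\<in>I. C z)"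
    by (auto simp: I_def C_def)
  have union': "{\<omega>. \<omega> n = x \<and> \<omega> (Suc n) = y} = (\<Union>z\<in>I. C' z)"
    using union by (auto simp: C'_eq)
  have "z = z'" if "z \<in> I" "z' \<in> I" "\<omega> \<in> C z" "\<omega> \<in> C z'" for z z' \<omega>
    by (rule PiE_ext[of _ "{..n}" "\<lambda>_. UNIV"]) (use that in \<open>auto simp: I_def C_def\<close>)
  then have disj: "disjoint_family_on C I"
    by (auto simp: disjoint_family_on_def)
  then have disj': "disjoint_family_on C' I"
    by (auto simp: disjoint_family_on_def C'_eq)
  have cyl: "emeasure ?P (C' z) = emeasure ?P (C z) * ?q" if "z \<in> I" for z
    using that unfolding C_def C'_def emeasure_process_law_cylinder
    by (simp add: I_def lessThan_Suc mult_ac)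
  have "emeasure ?P (\<Union>z\<in>I. C' z) = (\<integral>\<^sup>+z. emeasure ?P (C' z) \<partial>count_space I)"
    by (rule emeasure_UN_countable[OF _ I disj']) (unfold C'_def, rule sets_cylinder)
  also have "\<dots> = (\<integral>\<^sup>+z. emeasure ?P (C z) * ?q \<partial>count_space I)"
    by (intro nn_integral_cong) (simp add: cyl)
  also have "\<dots> = (\<integral>\<^sup>+z. emeasure ?P (C z) \<partial>count_space I) * ?q"
    by (rule nn_integral_multc) simp
  also have "(\<integral>\<^sup>+z. emeasure ?P (C z) \<partial>count_space I) = emeasure ?P (\<Union>z\<in>I. C z)"
    by (rule emeasure_UN_countable[OF _ I disj, symmetric]) (unfold C_def, rule sets_cylinder)
  finally show ?thesis
    by (simp add: union union')
qed

text \<open>Splitting over the state at stage \<open>n\<close> and applying the one-step law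
  reproduces the recursion of \<open>state_at\<close>.\<close>

lemma emeasure_process_law_state:
  "emeasure (process_law p \<pi> \<sigma> s) {\<omega>. \<omega> n = y} = ennreal (pmf (state_at p \<pi> \<sigma> n s) y)"
proof (induction n arbitrary: y)
  case 0
  show ?case
    using emeasure_process_law_cylinder[of p \<pi> \<sigma> s 0 "\<lambda>_. y"] by (auto simp: indicator_def)
next
  case (Suc n)
  let ?P = "process_law p \<pi> \<sigma> s"
  have "emeasure ?P {\<omega>. \<omega> (Suc n) = y} = emeasure ?P (\<Union>x. {\<omega>. \<omega> n = x \<and> \<omega> (Suc n) = y})"
    by (rule arg_cong[where f = "emeasure ?P"]) auto
  also have "\<dots> = (\<integral>\<^sup>+x. emeasure ?P {\<omega>. \<omega> n = x \<and> \<omega> (Suc n) = y} \<partial>count_space UNIV)"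
    by (intro emeasure_UN_countable) (auto simp: sets_two_coordinates disjoint_family_on_def)
  also have "\<dots> = ennreal (pmf (state_at p \<pi> \<sigma> (Suc n) s) y)"
    by (simp add: emeasure_process_law_step Suc ennreal_pmf_bind nn_integral_measure_pmf)
  finally show ?case .
qed

lemma distr_process_law_state:
  "distr (process_law p \<pi> \<sigma> s) (count_space UNIV) (\<lambda>\<omega>. \<omega> n) = measure_pmf (state_at p \<pi> \<sigma> n s)"
  by (rule measure_eqI_countable[of _ UNIV])
     (auto simp: emeasure_distr vimage_def space_process_law emeasure_process_law_state
        emeasure_pmf_single)

text \<open>The joint law of two successive states: a reward depends on both ends of a transition,
  so the marginals alone do not suffice.\<close>

definition transition_at ::
    "transitions \<Rightarrow> (nat \<Rightarrow> runner_rule) \<Rightarrow> (nat \<Rightarrow> pitcher_rule) \<Rightarrow> nat \<Rightarrow> state \<Rightarrow> (state \<times> state) pmf" where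
  "transition_at p \<pi> \<sigma> n s =
     bind_pmf (state_at p \<pi> \<sigma> n s) (\<lambda>x. map_pmf (Pair x) (next_pmf p (\<pi> n) (\<sigma> n) x))"

lemma pmf_transition_at:
  "pmf (transition_at p \<pi> \<sigma> n s) (x, y) =
     pmf (state_at p \<pi> \<sigma> n s) x * pmf (next_pmf p (\<pi> n) (\<sigma> n) x) y"
proof -
  \<comment> \<open>The law with first component \<open>x'\<close> charges \<open>(x, y)\<close>
    only for \<open>x' = x\<close>, so the mixture over \<open>x'\<close> reduces to one
    term.\<close>
  have "pmf (map_pmf (Pair x') N) (x, y) = (if x' = x then pmf N y else 0)" for x' and N :: "state pmf"
    by (auto simp: pmf_map_inj' inj_on_def intro!: pmf_map_outside)
  then show ?thesis
    unfolding transition_at_def pmf_bind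
    by (subst integral_measure_pmf[of "{x}"]) (auto split: if_splits)
qed

lemma distr_process_law_transition:
  "distr (process_law p \<pi> \<sigma> s) (count_space UNIV) (\<lambda>\<omega>. (\<omega> n, \<omega> (Suc n))) =
     measure_pmf (transition_at p \<pi> \<sigma> n s)"
proof (rule measure_eqI_countable[of _ UNIV])
  fix xy :: "state \<times> state"
  obtain x y where xy: "xy = (x, y)" by fastforce
  have [measurable]: "(\<lambda>\<omega>. (\<omega> n, \<omega> (Suc n))) \<in> measurable (process_law p \<pi> \<sigma> s) (count_space UNIV)"
    by measurable
  show "emeasure (distr (process_law p \<pi> \<sigma> s) (count_space UNIV) (\<lambda>\<omega>. (\<omega> n, \<omega> (Suc n)))) {xy} =
      emeasure (measure_pmf (transition_at p \<pi> \<sigma> n s)) {xy}"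
    by (simp add: xy emeasure_distr vimage_def space_process_law emeasure_process_law_step
        emeasure_process_law_state emeasure_pmf_single pmf_transition_at ennreal_mult')
qed auto

subsection \<open>Absorption and policy values\<close>

lemma finite_Live:
  assumes "finite B" "finite C" "finite D" "finite E"
  shows "finite {Live b c d outs | b c d outs. b \<in> B \<and> c \<in> C \<and> d \<in> D \<and> outs \<in> E}"
proof -
  have "{Live b c d outs | b c d outs. b \<in> B \<and> c \<in> C \<and> d \<in> D \<and> outs \<in> E} =
      (\<lambda>(b, c, d, outs). Live b c d outs) ` (B \<times> C \<times> D \<times> E)"
    by force
  then show ?thesis
    using assms by simp
qed

lemma finite_states: "finite states"
  unfolding states_def live_states_def penult_states_def
  by (intro finite_UnI finite_imageI finite_Live finite_cartesian_product finite.insertI finite.emptyI)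

lemma Terminal_in_states [simp]: "Terminal \<in> states"
  by (simp add: states_def)

text \<open>The sum runs over \<open>states\<close> only: an expectation if \<open>M\<close> is supported there.\<close>

definition mean :: "state pmf \<Rightarrow> (state \<Rightarrow> real) \<Rightarrow> real" where
  "mean M g = (\<Sum>x\<in>states. pmf M x * g x)"

lemma mean_return: "s \<in> states \<Longrightarrow> mean (return_pmf s) g = g s"
  by (simp add: mean_def indicator_def finite_states if_distrib cong: if_cong)

lemma mean_const: "set_pmf M \<subseteq> states \<Longrightarrow> mean M (\<lambda>_. c) = c"
  using sum_pmf_eq_1[of states M] by (simp add: mean_def finite_states flip: sum_distrib_right)

lemma mean_mono: "(\<And>x. x \<in> states \<Longrightarrow> g x \<le> g' x) \<Longrightarrow> mean M g \<le> mean M g'"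
  unfolding mean_def by (intro sum_mono mult_left_mono) auto

lemma mean_add: "mean M (\<lambda>x. g x + g' x) = mean M g + mean M g'"
  by (simp add: mean_def sum.distrib algebra_simps)

lemma mean_diff: "mean M (\<lambda>x. g x - g' x) = mean M g - mean M g'"
  by (simp add: mean_def sum_subtractf algebra_simps)

lemma mean_cmult: "mean M (\<lambda>x. c * g x) = c * mean M g"
  by (simp add: mean_def sum_distrib_left algebra_simps)

lemma abs_mean_le: "\<bar>mean M g\<bar> \<le> mean M (\<lambda>x. \<bar>g x\<bar>)"
  unfolding mean_def by (rule order_trans[OF sum_abs]) (simp add: abs_mult)

text \<open>An exchange of two finite sums; the support hypothesis on \<open>M\<close> turns the
  integral behind \<open>pmf_bind\<close> into a sum over \<open>states\<close>.\<close>

lemma mean_bind: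
  assumes "set_pmf M \<subseteq> states"
  shows "mean (bind_pmf M f) g = mean M (\<lambda>x. mean (f x) g)"
proof -
  have "pmf (bind_pmf M f) y = (\<Sum>x\<in>states. pmf M x * pmf (f x) y)" for y
    unfolding pmf_bind using assms by (subst integral_measure_pmf[OF finite_states]) auto
  then have "mean (bind_pmf M f) g = (\<Sum>y\<in>states. \<Sum>x\<in>states. pmf M x * pmf (f x) y * g y)"
    by (simp add: mean_def sum_distrib_right)
  also have "\<dots> = mean M (\<lambda>x. mean (f x) g)"
    unfolding mean_def by (subst sum.swap) (simp add: sum_distrib_left mult.assoc)
  finally show ?thesis .
qed

lemma prob_eq_mean:
  assumes "set_pmf M \<subseteq> states"
  shows "measure (measure_pmf M) A = mean M (\<lambda>x. of_bool (x \<in> A))"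
proof -
  have "measure (measure_pmf M) A = (\<integral>x. indicator A x \<partial>measure_pmf M)"
    by simp
  also have "\<dots> = (\<Sum>x\<in>states. pmf M x *\<^sub>R indicator A x)"
    using assms by (intro integral_measure_pmf finite_states) auto
  finally show ?thesis
    by (simp add: mean_def indicator_def of_bool_def)
qed

section \<open>Rewards, admissible actions and stage values\<close>

lemma reward_bounded: obtains R where "0 \<le> R" "\<And>x y. x \<in> states \<Longrightarrow> y \<in> states \<Longrightarrow> \<bar>reward x y\<bar> \<le> R"
proof
  let ?R = "\<Sum>(x, y)\<in>states \<times> states. \<bar>reward x y\<bar>"
  show "0 \<le> ?R"
    by (intro sum_nonneg) auto
  show "\<bar>reward x y\<bar> \<le> ?R" if "x \<in> states" "y \<in> states" for x y
    using that finite_states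
      member_le_sum[of "(x, y)" "states \<times> states" "\<lambda>(x, y). \<bar>reward x y\<bar>"] by force
qed

lemma reward_Terminal [simp]: "reward Terminal y = 0"
  by (cases y) auto

lemma finite_pitcher_actions: "finite (pitcher_actions s a)"
  by (auto simp: pitcher_actions_def)

lemma pitcher_actions_nonempty: "pitcher_actions s a \<noteq> {}"
  by (auto simp: pitcher_actions_def)

lemma rule_actions:
  assumes "f \<in> runner_rules" "h \<in> pitcher_rules" "s \<in> states"
  shows "f s \<in> runner_actions s" "h (s, f s) \<in> pitcher_actions s (f s)"
proof -
  show f: "f s \<in> runner_actions s"
    using assms by (auto simp: runner_rules_def)
  have "(s, f s) \<in> (SIGMA s:states. runner_actions s)"
    using assms f by auto
  then show "h (s, f s) \<in> pitcher_actions s (f s)"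
    using assms(2) unfolding pitcher_rules_def by (auto dest: PiE_mem)
qed

lemma policy_rules:
  assumes "\<pi> \<in> runner_policies" "\<sigma> \<in> pitcher_policies"
  shows "\<pi> n \<in> runner_rules" "\<sigma> n \<in> pitcher_rules"
    "(\<lambda>t. \<pi> (n + t)) \<in> runner_policies" "(\<lambda>t. \<sigma> (n + t)) \<in> pitcher_policies"
    "(\<lambda>t. \<pi> (Suc t)) \<in> runner_policies" "(\<lambda>t. \<sigma> (Suc t)) \<in> pitcher_policies"
  using assms by (auto simp: runner_policies_def pitcher_policies_def)

lemma stage_value_eq_mean:
  "stage_value p u s a a' = mean (p s a a') (\<lambda>y. reward s y + u y)"
  by (simp add: stage_value_def mean_def mult.commute)

text \<open>The rewards cancel, leaving the transition law applied to the difference of the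
  continuation values. Every use of the comparison principle rests on this.\<close>

lemma stage_value_diff:
  "stage_value p u s a a' - stage_value p v s a a' = mean (p s a a') (\<lambda>y. u y - v y)"
  by (simp add: stage_value_eq_mean flip: mean_diff)

section \<open>Survival probabilities and expected stage rewards\<close>

definition survival ::
    "transitions \<Rightarrow> (nat \<Rightarrow> runner_rule) \<Rightarrow> (nat \<Rightarrow> pitcher_rule) \<Rightarrow> nat \<Rightarrow> state \<Rightarrow> real" where
  "survival p \<pi> \<sigma> n s = mean (state_at p \<pi> \<sigma> n s) (\<lambda>x. of_bool (x \<noteq> Terminal))"

definition expected_reward ::
    "transitions \<Rightarrow> (nat \<Rightarrow> runner_rule) \<Rightarrow> (nat \<Rightarrow> pitcher_rule) \<Rightarrow> nat \<Rightarrow> state \<Rightarrow> real" where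
  "expected_reward p \<pi> \<sigma> n s =
     mean (state_at p \<pi> \<sigma> n s) (\<lambda>x. mean (next_pmf p (\<pi> n) (\<sigma> n) x) (reward x))"

locale game =
  fixes p :: transitions
  assumes law: "transition_law p"
begin

lemma set_pmf_stage:
  "s \<in> states \<Longrightarrow> a \<in> runner_actions s \<Longrightarrow> a' \<in> pitcher_actions s a \<Longrightarrow> set_pmf (p s a a') \<subseteq> states"
  using law by (auto simp: transition_law_def)

lemma set_pmf_next:
  "f \<in> runner_rules \<Longrightarrow> h \<in> pitcher_rules \<Longrightarrow> s \<in> states \<Longrightarrow> set_pmf (next_pmf p f h s) \<subseteq> states"
  unfolding next_pmf_def by (intro set_pmf_stage rule_actions) auto

lemma next_pmf_Terminal:
  assumes "f \<in> runner_rules" "h \<in> pitcher_rules"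
  shows "next_pmf p f h Terminal = return_pmf Terminal"
  using rule_actions[OF assms Terminal_in_states] law
  by (auto simp: next_pmf_def runner_actions_def pitcher_actions_def transition_law_def)

context
  fixes \<pi> \<sigma>
  assumes policies: "\<pi> \<in> runner_policies" "\<sigma> \<in> pitcher_policies"
begin

lemma set_pmf_state_at: "s \<in> states \<Longrightarrow> set_pmf (state_at p \<pi> \<sigma> n s) \<subseteq> states"
proof (induction n)
  case (Suc n)
  then show ?case
    using set_pmf_next[OF policy_rules(1,2)[OF policies]] by fastforce
qed simp

lemma state_at_Terminal: "state_at p \<pi> \<sigma> n Terminal = return_pmf Terminal"
  by (induction n) (simp_all add: bind_return_pmf next_pmf_Terminal policy_rules[OF policies])

text \<open>Translates the absorption hypothesis, which speaks of the path measure, into a statement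
  about \<open>survival\<close>.\<close>

lemma prob_not_Terminal:
  assumes "s \<in> states"
  shows "measure (process_law p \<pi> \<sigma> s) {\<omega>. \<omega> n \<noteq> Terminal} = survival p \<pi> \<sigma> n s"
proof -
  have "measure (process_law p \<pi> \<sigma> s) {\<omega>. \<omega> n \<noteq> Terminal} =
      measure (distr (process_law p \<pi> \<sigma> s) (count_space UNIV) (\<lambda>\<omega>. \<omega> n)) (- {Terminal})"
    by (subst measure_distr) (auto simp: space_process_law vimage_def)
  also have "\<dots> = survival p \<pi> \<sigma> n s"
    unfolding distr_process_law_state survival_def
    by (subst prob_eq_mean) (auto simp: set_pmf_state_at assms)
  finally show ?thesis .
qed

text \<open>The pair of successive states has a law with finite support, so every function of it is
  integrable and its integral is a finite double sum.\<close>

lemma process_law_transition: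
  fixes g :: "state \<Rightarrow> state \<Rightarrow> real"
  assumes s: "s \<in> states"
  shows integrable_transition: "integrable (process_law p \<pi> \<sigma> s) (\<lambda>\<omega>. g (\<omega> n) (\<omega> (Suc n)))"
    and integral_transition: "(\<integral>\<omega>. g (\<omega> n) (\<omega> (Suc n)) \<partial>process_law p \<pi> \<sigma> s) =
      mean (state_at p \<pi> \<sigma> n s) (\<lambda>x. mean (next_pmf p (\<pi> n) (\<sigma> n) x) (g x))"
proof -
  let ?P = "process_law p \<pi> \<sigma> s" and ?T = "transition_at p \<pi> \<sigma> n s"
  have [measurable]: "(\<lambda>\<omega>. (\<omega> n, \<omega> (Suc n))) \<in> measurable ?P (count_space UNIV)"
    by measurable
  have T: "set_pmf ?T \<subseteq> states \<times> states"
    using set_pmf_state_at[OF s, of n] set_pmf_next[OF policy_rules(1,2)[OF policies]]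
    by (fastforce simp: transition_at_def)
  have fin: "finite (states \<times> states)"
    using finite_states by simp
  have "integrable ?T (\<lambda>(x, y). g x y)"
    by (intro integrable_measure_pmf_finite finite_subset[OF T fin])
  then have "integrable (distr ?P (count_space UNIV) (\<lambda>\<omega>. (\<omega> n, \<omega> (Suc n)))) (\<lambda>(x, y). g x y)"
    by (simp add: distr_process_law_transition)
  then show "integrable ?P (\<lambda>\<omega>. g (\<omega> n) (\<omega> (Suc n)))"
    by (subst (asm) integrable_distr_eq) auto
  have "(\<integral>\<omega>. g (\<omega> n) (\<omega> (Suc n)) \<partial>?P) =
      (\<integral>xy. (case xy of (x, y) \<Rightarrow> g x y) \<partial>distr ?P (count_space UNIV) (\<lambda>\<omega>. (\<omega> n, \<omega> (Suc n))))"
    by (subst integral_distr) auto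
  also have "\<dots> = (\<integral>xy. (case xy of (x, y) \<Rightarrow> g x y) \<partial>?T)"
    by (simp only: distr_process_law_transition)
  also have "\<dots> = (\<Sum>xy\<in>states \<times> states. pmf ?T xy *\<^sub>R (case xy of (x, y) \<Rightarrow> g x y))"
    using T by (intro integral_measure_pmf fin) auto
  also have "\<dots> = (\<Sum>(x, y)\<in>states \<times> states.
      pmf (state_at p \<pi> \<sigma> n s) x * (pmf (next_pmf p (\<pi> n) (\<sigma> n) x) y * g x y))"
    by (intro sum.cong) (auto simp: pmf_transition_at)
  also have "\<dots> = mean (state_at p \<pi> \<sigma> n s) (\<lambda>x. mean (next_pmf p (\<pi> n) (\<sigma> n) x) (g x))"
    by (simp add: mean_def sum_distrib_left sum.cartesian_product)
  finally show "(\<integral>\<omega>. g (\<omega> n) (\<omega> (Suc n)) \<partial>?P) =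
      mean (state_at p \<pi> \<sigma> n s) (\<lambda>x. mean (next_pmf p (\<pi> n) (\<sigma> n) x) (g x))" .
qed

text \<open>On \<open>states\<close>, \<open>g\<close> lies below \<open>K\<close> times the
  indicator of the states other than \<open>Terminal\<close>.\<close>

lemma mean_state_at_le_survival:
  assumes "s \<in> states" "g Terminal \<le> 0" "\<And>x. x \<in> states \<Longrightarrow> g x \<le> K"
  shows "mean (state_at p \<pi> \<sigma> n s) g \<le> K * survival p \<pi> \<sigma> n s"
proof -
  have "mean (state_at p \<pi> \<sigma> n s) g \<le> mean (state_at p \<pi> \<sigma> n s) (\<lambda>x. K * of_bool (x \<noteq> Terminal))"
    using assms by (intro mean_mono) auto
  then show ?thesis
    by (simp add: survival_def mean_cmult)
qed

lemma survival_nonneg: "0 \<le> survival p \<pi> \<sigma> n s"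
  unfolding survival_def mean_def by (intro sum_nonneg) auto

lemma survival_le_1: "s \<in> states \<Longrightarrow> survival p \<pi> \<sigma> n s \<le> 1"
  unfolding survival_def
  by (rule order_trans[OF mean_mono[of _ "\<lambda>_. 1"]]) (auto simp: mean_const set_pmf_state_at)

text \<open>Iterates the one-step inequality along the chain. Only stages below the horizon
  \<open>N\<close> are constrained, as fits the backward indexing of value iteration.\<close>

lemma mean_le_mean_state_at:
  assumes "\<And>n x. n < N \<Longrightarrow> x \<in> states \<Longrightarrow> D n x \<le> mean (next_pmf p (\<pi> n) (\<sigma> n) x) (D (Suc n))"
    and "s \<in> states"
  shows "D 0 s \<le> mean (state_at p \<pi> \<sigma> N s) (D N)"
  using assms(1)
proof (induction N)
  case (Suc N)
  have "D 0 s \<le> mean (state_at p \<pi> \<sigma> N s) (D N)"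
    using Suc by simp
  also have "\<dots> \<le> mean (state_at p \<pi> \<sigma> N s) (\<lambda>x. mean (next_pmf p (\<pi> N) (\<sigma> N) x) (D (Suc N)))"
    using Suc.prems by (intro mean_mono) simp
  also have "\<dots> = mean (state_at p \<pi> \<sigma> (Suc N) s) (D (Suc N))"
    by (simp add: mean_bind set_pmf_state_at assms(2))
  finally show ?case .
qed (simp add: mean_return assms(2))

end

text \<open>Surviving \<open>n + k\<close> stages means surviving \<open>n\<close> and then
  \<open>k\<close> more from the state reached; since \<open>Terminal\<close> is absorbing, it
  contributes nothing to the second phase.\<close>

lemma survival_add_le:
  assumes policies: "\<pi> \<in> runner_policies" "\<sigma> \<in> pitcher_policies" and s: "s \<in> states"
    and c: "\<And>x. x \<in> states \<Longrightarrow> survival p (\<lambda>t. \<pi> (n + t)) (\<lambda>t. \<sigma> (n + t)) k x \<le> c"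
  shows "survival p \<pi> \<sigma> (n + k) s \<le> c * survival p \<pi> \<sigma> n s"
proof -
  have "survival p \<pi> \<sigma> (n + k) s =
      mean (state_at p \<pi> \<sigma> n s) (survival p (\<lambda>t. \<pi> (n + t)) (\<lambda>t. \<sigma> (n + t)) k)"
    by (simp add: survival_def [abs_def] state_at_add mean_bind set_pmf_state_at[OF policies s])
  also have "\<dots> \<le> c * survival p \<pi> \<sigma> n s"
    by (intro mean_state_at_le_survival policies s c)
       (simp add: survival_def state_at_Terminal[OF policy_rules(3,4)[OF policies]] mean_return)
  finally show ?thesis .
qed

text \<open>Cut \<open>n\<close> into \<open>n div m\<close> blocks of length \<open>m\<close>, each
  costing a factor \<open>c\<close>, and a remainder costing at most a factor 1. Each block runs
  under shifted policies, so \<open>c\<close> has to be uniform in the policies.\<close>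

lemma survival_power_le:
  assumes c: "\<And>\<pi> \<sigma> s. \<pi> \<in> runner_policies \<Longrightarrow> \<sigma> \<in> pitcher_policies \<Longrightarrow> s \<in> states \<Longrightarrow>
      survival p \<pi> \<sigma> m s \<le> c" "0 \<le> c"
    and policies: "\<pi> \<in> runner_policies" "\<sigma> \<in> pitcher_policies" and s: "s \<in> states"
  shows "survival p \<pi> \<sigma> n s \<le> c ^ (n div m)"
proof -
  have *: "survival p \<pi> \<sigma> (j * m) s \<le> c ^ j" for j
  proof (induction j)
    case 0
    show ?case
      using survival_le_1[OF policies s] by simp
  next
    case (Suc j)
    have "survival p \<pi> \<sigma> (j * m + m) s \<le> c * survival p \<pi> \<sigma> (j * m) s"
      by (rule survival_add_le[OF policies s c(1)[OF policy_rules(3,4)[OF policies]]])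
    also have "\<dots> \<le> c * c ^ j"
      using Suc c(2) by (rule mult_left_mono)
    finally show ?case
      by (simp add: add.commute)
  qed
  have "survival p \<pi> \<sigma> (n div m * m + n mod m) s \<le> 1 * survival p \<pi> \<sigma> (n div m * m) s"
    by (rule survival_add_le[OF policies s survival_le_1[OF policy_rules(3,4)[OF policies]]])
  with *[of "n div m"] show ?thesis
    by simp
qed

end

text \<open>On each block of \<open>m\<close> indices the exponent is constant, so the sum over
  \<open>n\<close> blocks is \<open>m\<close> times a partial sum of a geometric series.\<close>

lemma summable_power_div:
  fixes c :: real
  assumes "0 \<le> c" "c < 1" "0 < m"
  shows "summable (\<lambda>n. c ^ (n div m))"
proof (rule summableI_nonneg_bounded)
  show "0 \<le> c ^ (n div m)" for n
    using assms by simp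
  fix n
  have "(\<Sum>k<n. c ^ (k div m)) \<le> (\<Sum>k<n * m. c ^ (k div m))"
    using assms by (intro sum_mono2) (auto intro: order.strict_trans2)
  also have "\<dots> = (\<Sum>j<n. \<Sum>k=j * m..<j * m + m. c ^ (k div m))"
    by (rule sum.nat_group[symmetric])
  also have "\<dots> = (\<Sum>j<n. \<Sum>k=j * m..<j * m + m. c ^ j)"
    using assms by (intro sum.cong refl arg_cong[where f = "power c"])
      (auto intro!: div_nat_eqI simp: mult.commute)
  also have "\<dots> = m * (\<Sum>j<n. c ^ j)"
    by (simp add: sum_distrib_left)
  also have "\<dots> \<le> m * (1 / (1 - c))"
    using assms sum_le_suminf[of "\<lambda>j. c ^ j" "{..<n}"] suminf_geometric[of c]
    by (intro mult_left_mono) (auto simp: summable_geometric)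
  finally show "(\<Sum>k<n. c ^ (k div m)) \<le> m * (1 / (1 - c))" .
qed

section \<open>Consequences of uniform absorption\<close>

locale absorbing_game = game +
  assumes absorption:
    "\<exists>m. (SUP (\<pi>, \<sigma>, s)\<in>runner_policies \<times> pitcher_policies \<times> states.
            measure (process_law p \<pi> \<sigma> s) {\<omega>. \<omega> m \<noteq> Terminal}) < 1"
begin

lemma survival_summable_bound:
  obtains \<beta> where "summable \<beta>"
    "\<And>n \<pi> \<sigma> s. \<pi> \<in> runner_policies \<Longrightarrow> \<sigma> \<in> pitcher_policies \<Longrightarrow> s \<in> states \<Longrightarrow>
      survival p \<pi> \<sigma> n s \<le> \<beta> n"
proof -
  let ?X = "runner_policies \<times> pitcher_policies \<times> states"
  let ?F = "\<lambda>m (\<pi>, \<sigma>, s). measure (process_law p \<pi> \<sigma> s) {\<omega>. \<omega> m \<noteq> Terminal}"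
  obtain m where m: "(SUP x\<in>?X. ?F m x) < 1"
    using absorption by blast
  \<comment> \<open>The maximum with 0 gives \<open>0 \<le> c\<close> without exhibiting a policy
    pair.\<close>
  define c where "c = max 0 (SUP x\<in>?X. ?F m x)"
  have c: "0 \<le> c" "c < 1"
    using m by (auto simp: c_def)
  have survival_m: "survival p \<pi> \<sigma> m s \<le> c"
    if "\<pi> \<in> runner_policies" "\<sigma> \<in> pitcher_policies" "s \<in> states" for \<pi> \<sigma> s
  proof -
    \<comment> \<open>A supremum of reals bounds its family only once the family is known to be
      bounded; probabilities are at most 1.\<close>
    have "bdd_above (?F m ` ?X)"
      by (rule bdd_aboveI[of _ 1]) (auto simp: prob_not_Terminal survival_le_1)
    then have "?F m (\<pi>, \<sigma>, s) \<le> (SUP x\<in>?X. ?F m x)"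
      using that by (intro cSUP_upper) auto
    then show ?thesis
      using that by (simp add: prob_not_Terminal c_def)
  qed
  \<comment> \<open>\<open>Suc m\<close> stages instead of \<open>m\<close>, so that dividing by the number of stages makes sense.\<close>
  have survival_Suc_m: "survival p \<pi> \<sigma> (Suc m) s \<le> c"
    if "\<pi> \<in> runner_policies" "\<sigma> \<in> pitcher_policies" "s \<in> states" for \<pi> \<sigma> s
  proof -
    have "survival p \<pi> \<sigma> (m + 1) s \<le> 1 * survival p \<pi> \<sigma> m s"
      by (rule survival_add_le[OF that survival_le_1[OF policy_rules(3,4)[OF that(1,2)]]])
    with survival_m[OF that] show ?thesis by simp
  qed
  show ?thesis
    by (rule that[of "\<lambda>n. c ^ (n div Suc m)"])
       (use survival_power_le[OF survival_Suc_m c(1)] c in \<open>auto intro: summable_power_div\<close>)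
qed

text \<open>The comparison principle. Iterating \<open>step\<close> bounds \<open>D 0 s\<close> by
  the mean of \<open>D n\<close> at stage \<open>n\<close>, which is at most \<open>K\<close> times
  the survival probability; that probability tends to 0.\<close>

lemma absorbed_nonpos:
  assumes policies: "\<pi> \<in> runner_policies" "\<sigma> \<in> pitcher_policies" and s: "s \<in> states"
    and step: "\<And>n x. x \<in> states \<Longrightarrow> D n x \<le> mean (next_pmf p (\<pi> n) (\<sigma> n) x) (D (Suc n))"
    and Terminal: "\<And>n. D n Terminal \<le> 0"
    and bound: "\<And>n x. x \<in> states \<Longrightarrow> D n x \<le> K"
  shows "D 0 s \<le> 0"
proof -
  obtain \<beta> where \<beta>: "summable \<beta>"
    "\<And>n \<pi> \<sigma> s. \<pi> \<in> runner_policies \<Longrightarrow> \<sigma> \<in> pitcher_policies \<Longrightarrow> s \<in> states \<Longrightarrow>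
      survival p \<pi> \<sigma> n s \<le> \<beta> n"
    by (rule survival_summable_bound) blast
  have "(\<lambda>n. survival p \<pi> \<sigma> n s) \<longlonglongrightarrow> 0"
    by (rule tendsto_sandwich[OF _ _ tendsto_const summable_LIMSEQ_zero[OF \<beta>(1)]])
       (simp_all add: \<beta>(2)[OF policies s] survival_nonneg[OF policies])
  then have "(\<lambda>n. K * survival p \<pi> \<sigma> n s) \<longlonglongrightarrow> K * 0"
    by (intro tendsto_mult tendsto_const)
  moreover have "D 0 s \<le> K * survival p \<pi> \<sigma> n s" for n
    using mean_le_mean_state_at[OF policies step s, of n]
      mean_state_at_le_survival[OF policies s, of "D n" K n] Terminal bound by force
  ultimately show ?thesis
    by (intro LIMSEQ_le_const[where X = "\<lambda>n. K * survival p \<pi> \<sigma> n s"]) auto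
qed

text \<open>Rewards are bounded by some \<open>R\<close> and vanish after absorption, so the
  expected absolute reward at stage \<open>n\<close> is at most \<open>R\<close> times the survival
  probability. The bound is uniform in policies and initial states.\<close>

lemma expected_reward_summable_bound:
  obtains \<gamma> where "summable \<gamma>"
    "\<And>n \<pi> \<sigma> s. \<pi> \<in> runner_policies \<Longrightarrow> \<sigma> \<in> pitcher_policies \<Longrightarrow> s \<in> states \<Longrightarrow>
      mean (state_at p \<pi> \<sigma> n s) (\<lambda>x. mean (next_pmf p (\<pi> n) (\<sigma> n) x) (\<lambda>y. \<bar>reward x y\<bar>)) \<le> \<gamma> n"
proof -
  obtain R where R: "0 \<le> R" "\<And>x y. x \<in> states \<Longrightarrow> y \<in> states \<Longrightarrow> \<bar>reward x y\<bar> \<le> R"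
    by (rule reward_bounded) blast
  obtain \<beta> where \<beta>: "summable \<beta>"
    "\<And>n \<pi> \<sigma> s. \<pi> \<in> runner_policies \<Longrightarrow> \<sigma> \<in> pitcher_policies \<Longrightarrow> s \<in> states \<Longrightarrow>
      survival p \<pi> \<sigma> n s \<le> \<beta> n"
    by (rule survival_summable_bound) blast
  show ?thesis
  proof (rule that[of "\<lambda>n. R * \<beta> n"])
    show "summable (\<lambda>n. R * \<beta> n)"
      using \<beta>(1) by (rule summable_mult)
    fix n \<pi> \<sigma> s
    assume policies: "\<pi> \<in> runner_policies" "\<sigma> \<in> pitcher_policies" and s: "s \<in> states"
    have "mean (next_pmf p (\<pi> n) (\<sigma> n) x) (\<lambda>y. \<bar>reward x y\<bar>) \<le> R" if "x \<in> states" for x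
      using mean_mono[of "\<lambda>y. \<bar>reward x y\<bar>" "\<lambda>_. R" "next_pmf p (\<pi> n) (\<sigma> n) x", OF R(2)[OF that]]
      by (simp add: mean_const set_pmf_next[OF policy_rules(1,2)[OF policies] that])
    then have "mean (state_at p \<pi> \<sigma> n s) (\<lambda>x. mean (next_pmf p (\<pi> n) (\<sigma> n) x) (\<lambda>y. \<bar>reward x y\<bar>))
        \<le> R * survival p \<pi> \<sigma> n s"
      by (intro mean_state_at_le_survival policies s) (simp_all add: mean_def)
    also have "\<dots> \<le> R * \<beta> n"
      by (intro mult_left_mono \<beta> policies s R)
    finally show "mean (state_at p \<pi> \<sigma> n s) (\<lambda>x. mean (next_pmf p (\<pi> n) (\<sigma> n) x) (\<lambda>y. \<bar>reward x y\<bar>))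
        \<le> R * \<beta> n" .
  qed
qed

section \<open>Total expected reward and its first-step recursion\<close>

lemma abs_expected_reward_le:
  "\<bar>expected_reward p \<pi> \<sigma> n s\<bar> \<le>
     mean (state_at p \<pi> \<sigma> n s) (\<lambda>x. mean (next_pmf p (\<pi> n) (\<sigma> n) x) (\<lambda>y. \<bar>reward x y\<bar>))"
  unfolding expected_reward_def
  by (rule order_trans[OF abs_mean_le mean_mono[OF abs_mean_le]])

lemma expected_reward_summable:
  assumes "\<pi> \<in> runner_policies" "\<sigma> \<in> pitcher_policies" "s \<in> states"
  shows "summable (\<lambda>n. expected_reward p \<pi> \<sigma> n s)"
proof -
  obtain \<gamma> where \<gamma>: "summable \<gamma>"
    "\<And>n \<pi> \<sigma> s. \<pi> \<in> runner_policies \<Longrightarrow> \<sigma> \<in> pitcher_policies \<Longrightarrow> s \<in> states \<Longrightarrow>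
      mean (state_at p \<pi> \<sigma> n s) (\<lambda>x. mean (next_pmf p (\<pi> n) (\<sigma> n) x) (\<lambda>y. \<bar>reward x y\<bar>)) \<le> \<gamma> n"
    by (rule expected_reward_summable_bound) blast
  show ?thesis
    by (rule summable_comparison_test'[OF \<gamma>(1), of 0])
       (use order_trans[OF abs_expected_reward_le \<gamma>(2)[OF assms]] in simp)
qed

text \<open>Expectation and infinite sum may be interchanged because the expected absolute rewards
  are summable.\<close>

lemma policy_value_eq_suminf:
  assumes policies: "\<pi> \<in> runner_policies" "\<sigma> \<in> pitcher_policies" and s: "s \<in> states"
  shows "policy_value p \<pi> \<sigma> s = (\<Sum>n. expected_reward p \<pi> \<sigma> n s)"
proof -
  let ?P = "process_law p \<pi> \<sigma> s"
  let ?r = "\<lambda>n \<omega>. reward (\<omega> n) (\<omega> (Suc n))"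
  obtain \<gamma> where \<gamma>: "summable \<gamma>"
    "\<And>n \<pi> \<sigma> s. \<pi> \<in> runner_policies \<Longrightarrow> \<sigma> \<in> pitcher_policies \<Longrightarrow> s \<in> states \<Longrightarrow>
      mean (state_at p \<pi> \<sigma> n s) (\<lambda>x. mean (next_pmf p (\<pi> n) (\<sigma> n) x) (\<lambda>y. \<bar>reward x y\<bar>)) \<le> \<gamma> n"
    by (rule expected_reward_summable_bound) blast
  have int: "integrable ?P (?r n)" for n
    by (rule integrable_transition[OF assms, of reward])
  have int_abs: "integrable ?P (\<lambda>\<omega>. \<bar>?r n \<omega>\<bar>)" for n
    by (rule integrable_transition[OF assms, of "\<lambda>x y. \<bar>reward x y\<bar>"])
  have meas: "(\<lambda>\<omega>. ennreal \<bar>?r n \<omega>\<bar>) \<in> borel_measurable ?P" for n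
    by (rule measurable_compose[OF borel_measurable_integrable[OF int_abs] measurable_ennreal])
  have le: "(\<integral>\<omega>. \<bar>?r n \<omega>\<bar> \<partial>?P) \<le> \<gamma> n" for n
    unfolding integral_transition[OF assms, of "\<lambda>x y. \<bar>reward x y\<bar>"] by (rule \<gamma>(2)[OF assms])
  have nonneg: "0 \<le> (\<integral>\<omega>. \<bar>?r n \<omega>\<bar> \<partial>?P)" for n
    by (rule Bochner_Integration.integral_nonneg) simp
  have summable: "summable (\<lambda>n. \<integral>\<omega>. \<bar>?r n \<omega>\<bar> \<partial>?P)"
    by (rule summable_comparison_test'[OF \<gamma>(1), of 0]) (simp only: real_norm_def abs_of_nonneg[OF nonneg] le)
  \<comment> \<open>By monotone convergence the expected total absolute reward is finite; hence
    almost every path has an absolutely summable reward series, as \<open>integral_suminf\<close>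
    demands.\<close>
  have "(\<integral>\<^sup>+\<omega>. (\<Sum>n. ennreal \<bar>?r n \<omega>\<bar>) \<partial>?P) = (\<Sum>n. \<integral>\<^sup>+\<omega>. ennreal \<bar>?r n \<omega>\<bar> \<partial>?P)"
    by (rule nn_integral_suminf[OF meas])
  also have "\<dots> = (\<Sum>n. ennreal (\<integral>\<omega>. \<bar>?r n \<omega>\<bar> \<partial>?P))"
    by (intro suminf_cong nn_integral_eq_integral[OF int_abs]) simp
  also have "\<dots> \<noteq> \<infinity>"
    using ennreal_suminf_neq_top[OF summable nonneg] by simp
  finally have "AE \<omega> in ?P. (\<Sum>n. ennreal \<bar>?r n \<omega>\<bar>) \<noteq> \<infinity>"
    by (rule nn_integral_PInf_AE[OF borel_measurable_suminf_order[OF meas]])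
  then have "AE \<omega> in ?P. summable (\<lambda>n. \<bar>?r n \<omega>\<bar>)"
    by eventually_elim (rule summable_suminf_not_top, simp_all)
  then have "(\<integral>\<omega>. (\<Sum>n. ?r n \<omega>) \<partial>?P) = (\<Sum>n. \<integral>\<omega>. ?r n \<omega> \<partial>?P)"
    by (intro integral_suminf int) (simp_all only: real_norm_def summable)
  then show ?thesis
    by (simp only: policy_value_def integral_transition[OF assms] expected_reward_def)
qed

text \<open>Uniformity in the policies is the point: it bounds the families whose real infima and
  suprema form \<open>optimal_value\<close>.\<close>

lemma policy_value_bounded:
  obtains B where "\<And>\<pi> \<sigma> s. \<pi> \<in> runner_policies \<Longrightarrow> \<sigma> \<in> pitcher_policies \<Longrightarrow> s \<in> states \<Longrightarrow>
    \<bar>policy_value p \<pi> \<sigma> s\<bar> \<le> B"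
proof -
  obtain \<gamma> where \<gamma>: "summable \<gamma>"
    "\<And>n \<pi> \<sigma> s. \<pi> \<in> runner_policies \<Longrightarrow> \<sigma> \<in> pitcher_policies \<Longrightarrow> s \<in> states \<Longrightarrow>
      mean (state_at p \<pi> \<sigma> n s) (\<lambda>x. mean (next_pmf p (\<pi> n) (\<sigma> n) x) (\<lambda>y. \<bar>reward x y\<bar>)) \<le> \<gamma> n"
    by (rule expected_reward_summable_bound) blast
  show ?thesis
  proof (rule that[of "suminf \<gamma>"])
    fix \<pi> \<sigma> s
    assume asm: "\<pi> \<in> runner_policies" "\<sigma> \<in> pitcher_policies" "s \<in> states"
    have "norm (\<Sum>n. expected_reward p \<pi> \<sigma> n s) \<le> suminf \<gamma>"
      by (rule norm_suminf_le[OF _ \<gamma>(1)])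
         (use order_trans[OF abs_expected_reward_le \<gamma>(2)[OF asm]] in simp)
    then show "\<bar>policy_value p \<pi> \<sigma> s\<bar> \<le> suminf \<gamma>"
      by (simp add: policy_value_eq_suminf asm)
  qed
qed

lemma policy_value_Terminal:
  assumes "\<pi> \<in> runner_policies" "\<sigma> \<in> pitcher_policies"
  shows "policy_value p \<pi> \<sigma> Terminal = 0"
  by (simp add: policy_value_eq_suminf assms expected_reward_def state_at_Terminal mean_return)
     (simp add: mean_def)

lemma expected_reward_Suc:
  assumes policies: "\<pi> \<in> runner_policies" "\<sigma> \<in> pitcher_policies" and s: "s \<in> states"
  shows "expected_reward p \<pi> \<sigma> (Suc n) s =
    mean (next_pmf p (\<pi> 0) (\<sigma> 0) s) (expected_reward p (\<lambda>t. \<pi> (Suc t)) (\<lambda>t. \<sigma> (Suc t)) n)"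
  using set_pmf_next[OF policy_rules(1,2)[OF policies] s]
  by (simp add: expected_reward_def [abs_def] state_at_Suc_shift mean_bind del: state_at.simps(2))

text \<open>The first reward is split off the series, and the tail is averaged over the next state.
  For stationary policies the shifted policies are the same ones, and this becomes the fixed-point
  equation.\<close>

lemma policy_value_step:
  assumes policies: "\<pi> \<in> runner_policies" "\<sigma> \<in> pitcher_policies" and s: "s \<in> states"
  shows "policy_value p \<pi> \<sigma> s =
    policy_operator p (\<pi> 0) (\<sigma> 0) (policy_value p (\<lambda>t. \<pi> (Suc t)) (\<lambda>t. \<sigma> (Suc t))) s"
proof -
  let ?e = "expected_reward p (\<lambda>t. \<pi> (Suc t)) (\<lambda>t. \<sigma> (Suc t))"
  let ?M = "next_pmf p (\<pi> 0) (\<sigma> 0) s"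
  have summable: "summable (\<lambda>n. ?e n x)" if "x \<in> states" for x
    using policies that by (intro expected_reward_summable policy_rules)
  have "policy_value p \<pi> \<sigma> s = expected_reward p \<pi> \<sigma> 0 s + (\<Sum>n. expected_reward p \<pi> \<sigma> (Suc n) s)"
    using suminf_split_head[OF expected_reward_summable[OF assms]]
    by (simp add: policy_value_eq_suminf assms)
  also have "(\<Sum>n. expected_reward p \<pi> \<sigma> (Suc n) s) = (\<Sum>n. \<Sum>x\<in>states. pmf ?M x * ?e n x)"
    by (simp add: expected_reward_Suc assms mean_def)
  also have "\<dots> = (\<Sum>x\<in>states. \<Sum>n. pmf ?M x * ?e n x)"
    by (intro suminf_sum summable_mult summable)
  also have "\<dots> = mean ?M (policy_value p (\<lambda>t. \<pi> (Suc t)) (\<lambda>t. \<sigma> (Suc t)))"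
    unfolding mean_def using policies
    by (intro sum.cong refl) (simp add: suminf_mult summable policy_value_eq_suminf policy_rules)
  also have "expected_reward p \<pi> \<sigma> 0 s = mean ?M (reward s)"
    by (simp add: expected_reward_def mean_return s)
  finally show ?thesis
    by (simp add: policy_operator_def stage_value_eq_mean next_pmf_def mean_add)
qed

text \<open>The difference of two fixed points equals its own one-step mean, so the comparison
  principle with \<open>D\<close> constant in \<open>n\<close> applies to it and to its
  negative.\<close>

lemma policy_value_stationary_unique:
  assumes f: "f \<in> runner_rules" and h: "h \<in> pitcher_rules"
    and Terminal: "u Terminal = 0" and u: "\<And>s. s \<in> states \<Longrightarrow> u s = policy_operator p f h u s"
    and s: "s \<in> states"
  shows "u s = policy_value p (\<lambda>_. f) (\<lambda>_. h) s"
proof -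
  let ?V = "policy_value p (\<lambda>_. f) (\<lambda>_. h)"
  have policies: "(\<lambda>_. f) \<in> runner_policies" "(\<lambda>_. h) \<in> pitcher_policies"
    using f h by (auto simp: runner_policies_def pitcher_policies_def)
  have V: "?V x = policy_operator p f h ?V x" if "x \<in> states" for x
    using policy_value_step[OF policies that] .
  have diff: "u x - ?V x = mean (next_pmf p f h x) (\<lambda>y. u y - ?V y)" if "x \<in> states" for x
    unfolding next_pmf_def stage_value_diff[symmetric]
    using u[OF that] V[OF that] by (simp add: policy_operator_def)
  have diff': "?V x - u x = mean (next_pmf p f h x) (\<lambda>y. ?V y - u y)" if "x \<in> states" for x
    using diff[OF that] by (simp add: mean_diff)
  define K where "K = Max ((\<lambda>x. \<bar>u x - ?V x\<bar>) ` states)"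
  have K: "u x - ?V x \<le> K" "?V x - u x \<le> K" if "x \<in> states" for x
  proof -
    have "\<bar>u x - ?V x\<bar> \<le> K"
      unfolding K_def using that finite_states by (intro Max_ge) auto
    then show "u x - ?V x \<le> K" "?V x - u x \<le> K"
      by auto
  qed
  have "u s - ?V s \<le> 0"
    by (rule absorbed_nonpos[OF policies s, where D = "\<lambda>_ x. u x - ?V x" and K = K])
       (use diff K Terminal policy_value_Terminal[OF policies] in auto)
  moreover have "?V s - u s \<le> 0"
    by (rule absorbed_nonpos[OF policies s, where D = "\<lambda>_ x. ?V x - u x" and K = K])
       (use diff' K Terminal policy_value_Terminal[OF policies] in auto)
  ultimately show ?thesis
    by simp
qed

section \<open>Minimizing replies of the pitcher\<close>

lemma guaranteed_value_le:
  "a' \<in> pitcher_actions s a \<Longrightarrow> guaranteed_value p u s a \<le> stage_value p u s a a'"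
  unfolding guaranteed_value_def by (intro Min_le) (auto simp: finite_pitcher_actions)

lemma minimizing_rule:
  obtains h where "h \<in> pitcher_rules"
    "\<And>s a. s \<in> states \<Longrightarrow> a \<in> runner_actions s \<Longrightarrow>
      guaranteed_value p u s a = stage_value p u s a (h (s, a))"
proof -
  let ?K = "SIGMA s:states. runner_actions s"
  have "\<exists>a'\<in>pitcher_actions s a. guaranteed_value p u s a = stage_value p u s a a'" for s a
    using Min_in[of "stage_value p u s a ` pitcher_actions s a"]
      finite_pitcher_actions[of s a] pitcher_actions_nonempty[of s a]
    unfolding guaranteed_value_def by blast
  then obtain k where k: "\<And>s a. k s a \<in> pitcher_actions s a"
    "\<And>s a. guaranteed_value p u s a = stage_value p u s a (k s a)"
    by metis
  show ?thesis
  proof (rule that[of "restrict (\<lambda>(s, a). k s a) ?K"])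
    show "restrict (\<lambda>(s, a). k s a) ?K \<in> pitcher_rules"
      unfolding pitcher_rules_def by (auto intro!: restrict_PiE simp: k)
  qed (use k in auto)
qed

end

subsection \<open>The Bellman operator\<close>

locale continuous_absorbing_game = absorbing_game +
  assumes continuity:
    "\<And>s aR aP lR lP s'.
       \<lbrakk>s \<in> states;
        \<And>k :: nat. aR k \<in> runner_actions s; \<And>k. aP k \<in> pitcher_actions s (aR k);
        aR \<longlonglongrightarrow> lR; lR \<in> runner_actions s; aP \<longlonglongrightarrow> lP; lP \<in> pitcher_actions s lR;
        s' \<in> states\<rbrakk>
       \<Longrightarrow> (\<lambda>k. pmf (p s (aR k) (aP k)) s') \<longlonglongrightarrow> pmf (p s lR lP) s'"
begin

text \<open>At a steal state the guaranteed value is the minimum of two continuous functions on the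
  compact interval from 0 to 20; elsewhere there is a single action.\<close>

lemma guaranteed_value_attains_max:
  assumes s: "s \<in> states"
  obtains a where "a \<in> runner_actions s"
    "\<And>b. b \<in> runner_actions s \<Longrightarrow> guaranteed_value p u s b \<le> guaranteed_value p u s a"
proof (cases "steal_state s")
  case True
  have actions: "runner_actions s = Num ` {0..20}" "pitcher_actions s a = {Num 0, Num 1}" for a
    using True by (simp_all add: runner_actions_def pitcher_actions_def)
  \<comment> \<open>The hypothesis \<open>continuity\<close> is used with the pitcher's action held
    constant, and gives continuity in sequential form.\<close>
  have "continuous_on {0..20} (\<lambda>x. stage_value p u s (Num x) a')" if "a' \<in> {Num 0, Num 1}" for a'
    unfolding continuous_on_sequentially comp_def
  proof (intro allI ballI impI)
    fix X l assume l: "l \<in> {0..20::real}" and X: "(\<forall>n. X n \<in> {0..20}) \<and> X \<longlonglongrightarrow> l"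
    have "(\<lambda>k. pmf (p s (Num (X k)) a') s') \<longlonglongrightarrow> pmf (p s (Num l) a') s'" if "s' \<in> states" for s'
      using s X l \<open>a' \<in> _\<close> that
      by (intro continuity) (auto simp: actions tendsto_Num_iff)
    then show "(\<lambda>n. stage_value p u s (Num (X n)) a') \<longlonglongrightarrow> stage_value p u s (Num l) a'"
      unfolding stage_value_def by (intro tendsto_intros)
  qed
  then have "continuous_on {0..20} (\<lambda>x. guaranteed_value p u s (Num x))"
    unfolding guaranteed_value_def actions by (simp add: continuous_on_min)
  then obtain x where "x \<in> {0..20}"
    "\<And>y. y \<in> {0..20} \<Longrightarrow> guaranteed_value p u s (Num y) \<le> guaranteed_value p u s (Num x)"
    using continuous_attains_sup[of "{0..20::real}" "\<lambda>x. guaranteed_value p u s (Num x)"] by auto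
  then show ?thesis
    by (intro that[of "Num x"]) (auto simp: actions)
next
  case False
  then show ?thesis
    by (intro that[of Dummy]) (auto simp: runner_actions_def)
qed

lemma bellman_operator_eq:
  assumes "a \<in> runner_actions s"
    "\<And>b. b \<in> runner_actions s \<Longrightarrow> guaranteed_value p u s b \<le> guaranteed_value p u s a"
  shows "bellman_operator p u s = guaranteed_value p u s a"
  unfolding bellman_operator_def using assms by (intro cSup_eq_maximum) auto

lemma maximizing_rule:
  obtains f where "f \<in> runner_rules"
    "\<And>s. s \<in> states \<Longrightarrow> bellman_operator p u s = guaranteed_value p u s (f s)"
proof -
  have "\<exists>a\<in>runner_actions s. bellman_operator p u s = guaranteed_value p u s a" if s: "s \<in> states" for s
  proof -
    obtain a where "a \<in> runner_actions s"
      "\<And>b. b \<in> runner_actions s \<Longrightarrow> guaranteed_value p u s b \<le> guaranteed_value p u s a"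
      by (rule guaranteed_value_attains_max[OF s, of u]) blast
    then show ?thesis
      using bellman_operator_eq[of a s u] by blast
  qed
  then obtain k where k: "\<And>s. s \<in> states \<Longrightarrow> k s \<in> runner_actions s"
    "\<And>s. s \<in> states \<Longrightarrow> bellman_operator p u s = guaranteed_value p u s (k s)"
    by metis
  show ?thesis
    by (rule that[of "restrict k states"]) (auto simp: runner_rules_def k)
qed

text \<open>Going through a maximizer replaces a separate proof that the values are bounded
  above.\<close>

lemma guaranteed_value_le_bellman:
  assumes "s \<in> states" "a \<in> runner_actions s"
  shows "guaranteed_value p u s a \<le> bellman_operator p u s"
proof -
  obtain a' where "a' \<in> runner_actions s"
    "\<And>b. b \<in> runner_actions s \<Longrightarrow> guaranteed_value p u s b \<le> guaranteed_value p u s a'"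
    by (rule guaranteed_value_attains_max[OF assms(1), of u]) blast
  then show ?thesis
    using bellman_operator_eq[of a' s u] assms(2) by simp
qed

text \<open>Take \<open>f\<close> maximizing for \<open>u\<close> and \<open>h\<close> minimizing
  for \<open>v\<close>. At this pair the stage value of \<open>u\<close> is at least
  \<open>bellman_operator p u s\<close> and that of \<open>v\<close> at most
  \<open>bellman_operator p v s\<close>; the rewards then cancel.\<close>

lemma bellman_operator_diff_le:
  obtains f h where "f \<in> runner_rules" "h \<in> pitcher_rules"
    "\<And>s. s \<in> states \<Longrightarrow> bellman_operator p u s - bellman_operator p v s \<le>
      mean (next_pmf p f h s) (\<lambda>y. u y - v y)"
proof -
  obtain f where f: "f \<in> runner_rules"
    "\<And>s. s \<in> states \<Longrightarrow> bellman_operator p u s = guaranteed_value p u s (f s)"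
    by (rule maximizing_rule) blast
  obtain h where h: "h \<in> pitcher_rules" "\<And>s a. s \<in> states \<Longrightarrow> a \<in> runner_actions s \<Longrightarrow>
      guaranteed_value p v s a = stage_value p v s a (h (s, a))"
    by (rule minimizing_rule) blast
  show ?thesis
  proof (rule that[OF f(1) h(1)])
    fix s assume s: "s \<in> states"
    note actions = rule_actions[OF f(1) h(1) s]
    have "bellman_operator p u s \<le> stage_value p u s (f s) (h (s, f s))"
      using f(2)[OF s] guaranteed_value_le[OF actions(2)] by simp
    moreover have "stage_value p v s (f s) (h (s, f s)) \<le> bellman_operator p v s"
      using guaranteed_value_le_bellman[OF s actions(1), of v] h(2)[OF s actions(1)] by simp
    ultimately show "bellman_operator p u s - bellman_operator p v s \<le>
        mean (next_pmf p f h s) (\<lambda>y. u y - v y)"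
      unfolding next_pmf_def stage_value_diff[symmetric] by simp
  qed
qed

section \<open>Convergence of value iteration\<close>

lemma bellman_operator_Terminal: "u Terminal = 0 \<Longrightarrow> bellman_operator p u Terminal = 0"
  using law
  by (simp add: bellman_operator_def guaranteed_value_def runner_actions_def pitcher_actions_def
      stage_value_eq_mean transition_law_def mean_return)

lemma bellman_iterates_Terminal:
  "u Terminal = 0 \<Longrightarrow> (bellman_operator p ^^ n) u Terminal = 0"
  by (induction n) (simp_all add: bellman_operator_Terminal)

text \<open>Each application of the operator contributes its own pair of rules. Strung together they
  form a Markovian, in general nonstationary, policy pair, whose survival probability controls the
  difference of the iterates.\<close>

lemma bellman_iterates_diff_le:
  assumes K: "\<And>x. x \<in> states \<Longrightarrow> u x - v x \<le> K" and Terminal: "u Terminal = 0" "v Terminal = 0"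
    and \<beta>: "\<And>\<pi> \<sigma>. \<pi> \<in> runner_policies \<Longrightarrow> \<sigma> \<in> pitcher_policies \<Longrightarrow> survival p \<pi> \<sigma> N s \<le> \<beta>"
    and s: "s \<in> states" and "0 \<le> K"
  shows "(bellman_operator p ^^ N) u s - (bellman_operator p ^^ N) v s \<le> K * \<beta>"
proof -
  let ?T = "bellman_operator p"
  \<comment> \<open>Stages count down the iterates: \<open>D 0\<close> compares the
    \<open>N\<close>-th iterates and \<open>D N\<close> is \<open>u - v\<close>.\<close>
  define D where "D n x = (?T ^^ (N - n)) u x - (?T ^^ (N - n)) v x" for n x
  \<comment> \<open>From stage \<open>N\<close> on only admissibility is asked, so that the chosen
    sequences are policies at all stages.\<close>
  have "\<exists>f h. f \<in> runner_rules \<and> h \<in> pitcher_rules \<and>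
      (n < N \<longrightarrow> (\<forall>x\<in>states. D n x \<le> mean (next_pmf p f h x) (D (Suc n))))" for n
  proof -
    define k where "k = N - Suc n"
    obtain f h where fh: "f \<in> runner_rules" "h \<in> pitcher_rules"
      "\<And>x. x \<in> states \<Longrightarrow> ?T ((?T ^^ k) u) x - ?T ((?T ^^ k) v) x \<le>
        mean (next_pmf p f h x) (\<lambda>y. (?T ^^ k) u y - (?T ^^ k) v y)"
      by (rule bellman_operator_diff_le[of "(?T ^^ k) u" "(?T ^^ k) v"]) blast
    have "D n x \<le> mean (next_pmf p f h x) (D (Suc n))" if "n < N" "x \<in> states" for x
    proof -
      have "N - n = Suc k"
        using that by (simp add: k_def)
      then have "D n x = ?T ((?T ^^ k) u) x - ?T ((?T ^^ k) v) x"
        by (simp add: D_def)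
      moreover have "D (Suc n) = (\<lambda>y. (?T ^^ k) u y - (?T ^^ k) v y)"
        by (simp add: D_def k_def fun_eq_iff)
      ultimately show ?thesis
        using fh(3)[OF that(2)] by simp
    qed
    with fh(1,2) show ?thesis
      by blast
  qed
  then have "\<exists>\<pi>. \<forall>n. \<exists>h. \<pi> n \<in> runner_rules \<and> h \<in> pitcher_rules \<and>
      (n < N \<longrightarrow> (\<forall>x\<in>states. D n x \<le> mean (next_pmf p (\<pi> n) h x) (D (Suc n))))"
    by (intro choice allI)
  then obtain \<pi> where "\<forall>n. \<exists>h. \<pi> n \<in> runner_rules \<and> h \<in> pitcher_rules \<and>
      (n < N \<longrightarrow> (\<forall>x\<in>states. D n x \<le> mean (next_pmf p (\<pi> n) h x) (D (Suc n))))"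
    by blast
  from choice[OF this] obtain \<sigma> where rules: "\<And>n. \<pi> n \<in> runner_rules" "\<And>n. \<sigma> n \<in> pitcher_rules"
    and step: "\<And>n x. n < N \<Longrightarrow> x \<in> states \<Longrightarrow> D n x \<le> mean (next_pmf p (\<pi> n) (\<sigma> n) x) (D (Suc n))"
    by blast
  have policies: "\<pi> \<in> runner_policies" "\<sigma> \<in> pitcher_policies"
    using rules by (auto simp: runner_policies_def pitcher_policies_def)
  have "D 0 s \<le> mean (state_at p \<pi> \<sigma> N s) (D N)"
    by (rule mean_le_mean_state_at[OF policies step s])
  also have "\<dots> \<le> K * survival p \<pi> \<sigma> N s"
    using K Terminal by (intro mean_state_at_le_survival policies s) (auto simp: D_def)
  also have "\<dots> \<le> K * \<beta>"
    by (intro mult_left_mono \<beta> policies \<open>0 \<le> K\<close>)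
  finally show ?thesis
    by (simp add: D_def)
qed

text \<open>The operator is Lipschitz for the sum norm on the finite carrier: bound each transition
  probability in \<open>bellman_operator_diff_le\<close> by 1.\<close>

lemma bellman_operator_tendsto:
  assumes U: "\<And>x. x \<in> states \<Longrightarrow> (\<lambda>n. U n x) \<longlonglongrightarrow> u x" and s: "s \<in> states"
  shows "(\<lambda>n. bellman_operator p (U n) s) \<longlonglongrightarrow> bellman_operator p u s"
proof -
  have diff: "bellman_operator p v s - bellman_operator p w s \<le> (\<Sum>x\<in>states. \<bar>v x - w x\<bar>)" for v w
  proof -
    obtain f h where "\<And>s. s \<in> states \<Longrightarrow> bellman_operator p v s - bellman_operator p w s \<le>
        mean (next_pmf p f h s) (\<lambda>y. v y - w y)"
      by (rule bellman_operator_diff_le[of v w]) blast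
    then have "bellman_operator p v s - bellman_operator p w s \<le>
        mean (next_pmf p f h s) (\<lambda>y. v y - w y)"
      using s by blast
    also have "\<dots> \<le> (\<Sum>x\<in>states. \<bar>v x - w x\<bar>)"
      unfolding mean_def
    proof (intro sum_mono)
      fix x
      have "pmf (next_pmf p f h s) x * (v x - w x) \<le> pmf (next_pmf p f h s) x * \<bar>v x - w x\<bar>"
        by (intro mult_left_mono) auto
      also have "\<dots> \<le> 1 * \<bar>v x - w x\<bar>"
        by (intro mult_right_mono pmf_le_1) auto
      finally show "pmf (next_pmf p f h s) x * (v x - w x) \<le> \<bar>v x - w x\<bar>"
        by simp
    qed
    finally show ?thesis .
  qed
  have "\<forall>n. norm (bellman_operator p (U n) s - bellman_operator p u s) \<le> (\<Sum>x\<in>states. \<bar>U n x - u x\<bar>)"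
  proof
    fix n
    have "(\<Sum>x\<in>states. \<bar>u x - U n x\<bar>) = (\<Sum>x\<in>states. \<bar>U n x - u x\<bar>)"
      by (intro sum.cong refl abs_minus_commute)
    then have "- (bellman_operator p (U n) s - bellman_operator p u s) \<le> (\<Sum>x\<in>states. \<bar>U n x - u x\<bar>)"
      using diff[of u "U n"] by (simp only: minus_diff_eq)
    then show "norm (bellman_operator p (U n) s - bellman_operator p u s) \<le> (\<Sum>x\<in>states. \<bar>U n x - u x\<bar>)"
      unfolding real_norm_def by (rule abs_leI[OF diff])
  qed
  moreover have "(\<lambda>n. \<Sum>x\<in>states. \<bar>U n x - u x\<bar>) \<longlonglongrightarrow> 0"
    by (intro tendsto_null_sum tendsto_rabs_zero LIM_zero U)
  ultimately have "(\<lambda>n. bellman_operator p (U n) s - bellman_operator p u s) \<longlonglongrightarrow> 0"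
    by (rule Lim_null_comparison[OF always_eventually])
  then show ?thesis
    by (rule LIM_zero_cancel)
qed

lemma bellman_fixed_point_exists:
  obtains u where "u Terminal = 0" "\<And>s. s \<in> states \<Longrightarrow> u s = bellman_operator p u s"
proof -
  let ?T = "bellman_operator p"
  define U where "U n = (?T ^^ n) (\<lambda>_. 0)" for n
  \<comment> \<open>\<open>U 0\<close> vanishes, so \<open>K\<close> bounds the first increment of
    the iteration.\<close>
  define K where "K = Max ((\<lambda>x. \<bar>U 1 x\<bar>) ` states)"
  have K: "\<bar>U 1 x\<bar> \<le> K" if "x \<in> states" for x
    unfolding K_def using that finite_states by (intro Max_ge) auto
  have "0 \<le> K"
    using K[OF Terminal_in_states] by simp
  have U_Suc: "U (Suc n) = (?T ^^ n) (U 1)" for n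
    unfolding U_def by (simp add: funpow_swap1)
  have U_Terminal: "U n Terminal = 0" for n
    by (simp add: U_def bellman_iterates_Terminal)
  obtain \<beta> where \<beta>: "summable \<beta>"
    "\<And>n \<pi> \<sigma> s. \<pi> \<in> runner_policies \<Longrightarrow> \<sigma> \<in> pitcher_policies \<Longrightarrow> s \<in> states \<Longrightarrow>
      survival p \<pi> \<sigma> n s \<le> \<beta> n"
    by (rule survival_summable_bound) blast
  \<comment> \<open>The increment compares the \<open>n\<close>-th iterates started at
    \<open>U 1\<close> and at 0; both signs are needed. Its bound is summable, so the telescoping
    series of increments converges.\<close>
  have step: "\<bar>U (Suc n) s - U n s\<bar> \<le> K * \<beta> n" if s: "s \<in> states" for n s
  proof -
    have "(?T ^^ n) (U 1) s - (?T ^^ n) (\<lambda>_. 0) s \<le> K * \<beta> n"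
      by (rule bellman_iterates_diff_le[OF _ _ _ \<beta>(2) s \<open>0 \<le> K\<close>])
         (use K s U_Terminal in \<open>auto simp: abs_le_iff\<close>)
    moreover have "(?T ^^ n) (\<lambda>_. 0) s - (?T ^^ n) (U 1) s \<le> K * \<beta> n"
      by (rule bellman_iterates_diff_le[OF _ _ _ \<beta>(2) s \<open>0 \<le> K\<close>])
         (use K s U_Terminal in \<open>auto simp: abs_le_iff\<close>)
    ultimately show ?thesis
      unfolding U_Suc U_def[of n] by (simp add: abs_le_iff)
  qed
  have "convergent (\<lambda>n. U n s)" if "s \<in> states" for s
  proof -
    have "summable (\<lambda>n. U (Suc n) s - U n s)"
      using step[OF that] by (intro summable_comparison_test'[OF summable_mult[OF \<beta>(1), of K], of 0]) auto
    then have "convergent (\<lambda>n. \<Sum>k<n. U (Suc k) s - U k s)"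
      by (simp add: summable_iff_convergent)
    moreover have "U 0 s = 0"
      by (simp add: U_def)
    ultimately show ?thesis
      by (simp add: sum_lessThan_telescope[of "\<lambda>k. U k s"])
  qed
  then have lim: "(\<lambda>n. U n s) \<longlonglongrightarrow> lim (\<lambda>n. U n s)" if "s \<in> states" for s
    using that by (simp add: convergent_LIMSEQ_iff)
  show ?thesis
  proof (rule that[of "\<lambda>s. lim (\<lambda>n. U n s)"])
    show "lim (\<lambda>n. U n Terminal) = 0"
      by (simp add: U_Terminal)
    fix s assume s: "s \<in> states"
    have "(\<lambda>n. U (Suc n) s) \<longlonglongrightarrow> ?T (\<lambda>s. lim (\<lambda>n. U n s)) s"
      using bellman_operator_tendsto[OF lim s] by (simp add: U_def)
    moreover have "(\<lambda>n. U (Suc n) s) \<longlonglongrightarrow> lim (\<lambda>n. U n s)"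
      using lim[OF s] by (rule LIMSEQ_Suc)
    ultimately show "lim (\<lambda>n. U n s) = ?T (\<lambda>s. lim (\<lambda>n. U n s)) s"
      using LIMSEQ_unique by blast
  qed
qed

text \<open>The stationary policies of \<open>f\<close> and \<open>h\<close> form a saddle point
  with value \<open>u s\<close>, which squeezes the supremum of infima from both sides.\<close>

lemma bellman_fixed_point_eq_optimal_value:
  assumes Terminal: "u Terminal = 0" and u: "\<And>s. s \<in> states \<Longrightarrow> u s = bellman_operator p u s"
    and s: "s \<in> states"
  shows "u s = optimal_value p s"
proof -
  obtain f where f: "f \<in> runner_rules"
    "\<And>s. s \<in> states \<Longrightarrow> bellman_operator p u s = guaranteed_value p u s (f s)"
    by (rule maximizing_rule) blast
  obtain h where h: "h \<in> pitcher_rules" "\<And>s a. s \<in> states \<Longrightarrow> a \<in> runner_actions s \<Longrightarrow>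
      guaranteed_value p u s a = stage_value p u s a (h (s, a))"
    by (rule minimizing_rule) blast
  have f_policy: "(\<lambda>_. f) \<in> runner_policies" and h_policy: "(\<lambda>_. h) \<in> pitcher_policies"
    using f h by (auto simp: runner_policies_def pitcher_policies_def)
  obtain B where B: "\<And>\<pi> \<sigma> s. \<pi> \<in> runner_policies \<Longrightarrow> \<sigma> \<in> pitcher_policies \<Longrightarrow> s \<in> states \<Longrightarrow>
      \<bar>policy_value p \<pi> \<sigma> s\<bar> \<le> B"
    by (rule policy_value_bounded) blast
  define L where "L = Max ((\<lambda>x. \<bar>u x\<bar>) ` states)"
  have L: "\<bar>u x\<bar> \<le> L" if "x \<in> states" for x
    unfolding L_def using that finite_states by (intro Max_ge) auto
  \<comment> \<open>The value of the policies from stage \<open>n\<close> on. The opponent need not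
    be stationary, so the comparison function varies with \<open>n\<close>.\<close>
  let ?V = "\<lambda>\<pi> \<sigma> n. policy_value p (\<lambda>t. \<pi> (n + t)) (\<lambda>t. \<sigma> (n + t))"
  have V: "?V \<pi> \<sigma> n x = policy_operator p (\<pi> n) (\<sigma> n) (?V \<pi> \<sigma> (Suc n)) x"
    if "\<pi> \<in> runner_policies" "\<sigma> \<in> pitcher_policies" "x \<in> states" for \<pi> \<sigma> n x
    using policy_value_step[OF policy_rules(3,4)[OF that(1,2)] that(3), of n n] by simp
  have bound: "u x - ?V \<pi> \<sigma> n x \<le> L + B" "?V \<pi> \<sigma> n x - u x \<le> L + B"
    if "\<pi> \<in> runner_policies" "\<sigma> \<in> pitcher_policies" "x \<in> states" for \<pi> \<sigma> n x
    using B[OF policy_rules(3,4)[OF that(1,2)] that(3), of n n] L[OF that(3)] by auto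
  have V_Terminal: "?V \<pi> \<sigma> n Terminal = 0"
    if "\<pi> \<in> runner_policies" "\<sigma> \<in> pitcher_policies" for \<pi> \<sigma> n
    using that by (intro policy_value_Terminal policy_rules)
  have lower: "u s \<le> policy_value p (\<lambda>_. f) \<sigma> s" if \<sigma>: "\<sigma> \<in> pitcher_policies" for \<sigma>
  proof -
    have "u x - ?V (\<lambda>_. f) \<sigma> n x \<le>
        mean (next_pmf p f (\<sigma> n) x) (\<lambda>y. u y - ?V (\<lambda>_. f) \<sigma> (Suc n) y)"
      if x: "x \<in> states" for n x
    proof -
      have "u x \<le> stage_value p u x (f x) (\<sigma> n (x, f x))"
        using guaranteed_value_le[OF rule_actions(2)[OF f(1) policy_rules(2)[OF f_policy \<sigma>] x]]
        by (simp add: u[OF x] f(2)[OF x])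
      then show ?thesis
        unfolding next_pmf_def stage_value_diff[symmetric] V[OF f_policy \<sigma> x]
        by (simp add: policy_operator_def)
    qed
    then have "u s - ?V (\<lambda>_. f) \<sigma> 0 s \<le> 0"
      using Terminal V_Terminal[OF f_policy \<sigma>] bound(1)[OF f_policy \<sigma>]
      by (intro absorbed_nonpos[OF f_policy \<sigma> s, where D = "\<lambda>n x. u x - ?V (\<lambda>_. f) \<sigma> n x"]) auto
    then show ?thesis by simp
  qed
  have upper: "policy_value p \<pi> (\<lambda>_. h) s \<le> u s" if \<pi>: "\<pi> \<in> runner_policies" for \<pi>
  proof -
    have "?V \<pi> (\<lambda>_. h) n x - u x \<le>
        mean (next_pmf p (\<pi> n) h x) (\<lambda>y. ?V \<pi> (\<lambda>_. h) (Suc n) y - u y)"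
      if x: "x \<in> states" for n x
    proof -
      have a: "\<pi> n x \<in> runner_actions x"
        using policy_rules(1)[OF \<pi> h_policy] h(1) x by (rule rule_actions)
      have "stage_value p u x (\<pi> n x) (h (x, \<pi> n x)) \<le> u x"
        using guaranteed_value_le_bellman[OF x a, of u] by (simp add: u[OF x] h(2)[OF x a])
      then show ?thesis
        unfolding next_pmf_def stage_value_diff[symmetric] V[OF \<pi> h_policy x]
        by (simp add: policy_operator_def)
    qed
    then have "?V \<pi> (\<lambda>_. h) 0 s - u s \<le> 0"
      using Terminal V_Terminal[OF \<pi> h_policy] bound(2)[OF \<pi> h_policy]
      by (intro absorbed_nonpos[OF \<pi> h_policy s, where D = "\<lambda>n x. ?V \<pi> (\<lambda>_. h) n x - u x"]) auto
    then show ?thesis by simp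
  qed
  \<comment> \<open>Real infima and suprema obey their bounds only on bounded sets: \<open>B\<close>
    bounds the infima's families below, and \<open>inf_le\<close> bounds the supremum's family
    above.\<close>
  have bdd: "bdd_below ((\<lambda>\<sigma>. policy_value p \<pi> \<sigma> s) ` pitcher_policies)"
    if "\<pi> \<in> runner_policies" for \<pi>
    by (rule bdd_belowI[of _ "- B"]) (use B[OF that _ s] in \<open>force simp: abs_le_iff\<close>)
  have inf_le: "(INF \<sigma>\<in>pitcher_policies. policy_value p \<pi> \<sigma> s) \<le> u s"
    if "\<pi> \<in> runner_policies" for \<pi>
    using cINF_lower[OF bdd[OF that] h_policy] upper[OF that] by simp
  have "u s \<le> (INF \<sigma>\<in>pitcher_policies. policy_value p (\<lambda>_. f) \<sigma> s)"
    using h_policy lower by (intro cINF_greatest) auto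
  also have "\<dots> \<le> optimal_value p s"
    unfolding optimal_value_def using inf_le f_policy
    by (intro cSUP_upper) (auto intro!: bdd_aboveI[of _ "u s"])
  finally have "u s \<le> optimal_value p s" .
  moreover have "optimal_value p s \<le> u s"
    unfolding optimal_value_def using inf_le f_policy by (intro cSUP_least) auto
  ultimately show ?thesis
    by simp
qed

section \<open>The fixed-point property of the optimal value\<close>

lemma bellman_operator_cong:
  "(\<And>x. x \<in> states \<Longrightarrow> u x = v x) \<Longrightarrow> bellman_operator p u s = bellman_operator p v s"
  by (simp add: bellman_operator_def guaranteed_value_def stage_value_def [abs_def] cong: sum.cong)

text \<open>Some fixed point exists and any fixed point agrees with \<open>optimal_value\<close> on
  \<open>states\<close>, the only part of a function that the operator reads.\<close>

lemma optimal_value_fixed_point: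
  shows "optimal_value p Terminal = 0"
    and "s \<in> states \<Longrightarrow> optimal_value p s = bellman_operator p (optimal_value p) s"
proof -
  obtain u where u: "u Terminal = 0" "\<And>s. s \<in> states \<Longrightarrow> u s = bellman_operator p u s"
    by (rule bellman_fixed_point_exists) blast
  have eq: "u x = optimal_value p x" if "x \<in> states" for x
    using u that by (rule bellman_fixed_point_eq_optimal_value)
  show "optimal_value p Terminal = 0"
    using eq[OF Terminal_in_states] u(1) by simp
  show "optimal_value p s = bellman_operator p (optimal_value p) s" if "s \<in> states"
    using u(2)[OF that] eq[OF that] bellman_operator_cong[of u "optimal_value p" s] eq by simp
qed

end

text \<open>Attainment justifies reading the \<open>SUP\<close> in \<open>bellman_operator\<close>
  as a maximum. Equations and uniqueness are asserted on \<open>states\<close>, since the type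
  \<open>state\<close> is larger than the state space.\<close>

theorem proposition1:
  fixes p :: transitions
  assumes law: "transition_law p"
    and absorption:
      "\<exists>m. (SUP (\<pi>, \<sigma>, s)\<in>runner_policies \<times> pitcher_policies \<times> states.
              measure (process_law p \<pi> \<sigma> s) {\<omega>. \<omega> m \<noteq> Terminal}) < 1"
    and continuity:
      "\<And>s aR aP lR lP s'.
         \<lbrakk>s \<in> states;
          \<And>k :: nat. aR k \<in> runner_actions s; \<And>k. aP k \<in> pitcher_actions s (aR k);
          aR \<longlonglongrightarrow> lR; lR \<in> runner_actions s; aP \<longlonglongrightarrow> lP; lP \<in> pitcher_actions s lR;
          s' \<in> states\<rbrakk>
         \<Longrightarrow> (\<lambda>k. pmf (p s (aR k) (aP k)) s') \<longlonglongrightarrow> pmf (p s lR lP) s'"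
  shows
    (* the maximum in the Bellman operator is attained *)
    "(\<forall>u. u Terminal = 0 \<longrightarrow>
        (\<forall>s\<in>states. \<exists>a. is_arg_max (guaranteed_value p u s) (\<lambda>a. a \<in> runner_actions s) a))
     \<and>
     (optimal_value p Terminal = 0
      \<and> (\<forall>s\<in>states. optimal_value p s = bellman_operator p (optimal_value p) s)
      \<and> (\<forall>u. u Terminal = 0 \<and> (\<forall>s\<in>states. u s = bellman_operator p u s) \<longrightarrow>
             (\<forall>s\<in>states. u s = optimal_value p s)))
     \<and>
     (\<forall>f\<in>runner_rules. \<forall>h\<in>pitcher_rules.
        let V = policy_value p (\<lambda>_. f) (\<lambda>_. h) in
        V Terminal = 0
        \<and> (\<forall>s\<in>states. V s = policy_operator p f h V s)
        \<and> (\<forall>u. u Terminal = 0 \<and> (\<forall>s\<in>states. u s = policy_operator p f h u s) \<longrightarrow>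
               (\<forall>s\<in>states. u s = V s)))"
proof -
  interpret continuous_absorbing_game p
    by unfold_locales (fact law absorption continuity)+
  have "\<exists>a. is_arg_max (guaranteed_value p u s) (\<lambda>a. a \<in> runner_actions s) a"
    if s: "s \<in> states" for u s
  proof -
    obtain a where "a \<in> runner_actions s"
      "\<And>b. b \<in> runner_actions s \<Longrightarrow> guaranteed_value p u s b \<le> guaranteed_value p u s a"
      by (rule guaranteed_value_attains_max[OF s, of u]) blast
    then show ?thesis
      unfolding is_arg_max_def by (intro exI[of _ a]) (auto simp: not_less)
  qed
  moreover have "let V = policy_value p (\<lambda>_. f) (\<lambda>_. h) in
        V Terminal = 0
        \<and> (\<forall>s\<in>states. V s = policy_operator p f h V s)
        \<and> (\<forall>u. u Terminal = 0 \<and> (\<forall>s\<in>states. u s = policy_operator p f h u s) \<longrightarrow>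
               (\<forall>s\<in>states. u s = V s))"
    if f: "f \<in> runner_rules" and h: "h \<in> pitcher_rules" for f h
  proof -
    have policies: "(\<lambda>_. f) \<in> runner_policies" "(\<lambda>_. h) \<in> pitcher_policies"
      using f h by (auto simp: runner_policies_def pitcher_policies_def)
    show ?thesis
      unfolding Let_def
      using policy_value_Terminal[OF policies] policy_value_step[OF policies]
        policy_value_stationary_unique[OF f h] by blast
  qed
  ultimately show ?thesis
    using optimal_value_fixed_point bellman_fixed_point_eq_optimal_value by blast
qed

end
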